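(* Let $G\in\mathbb{C}[x_0,x_1,x_2]$ be homogeneous of degree $n\ge 2$ defining a smooth projective plane curve $X\subset\mathbb{P}^2$, let $G_i=\partial G/\partial x_i$, and let $U_0,U_1,U_2\in\mathbb{C}[x_0,x_1,x_2]$ be homogeneous with $\deg U_0=\deg U_2=2n-3$ and $\deg U_1=n-3$. Suppose that $$U_0U_1=\sum_{i=0}^2R_i^{(01)}G_i,\qquad U_1U_2=\sum_{i=0}^2R_i^{(12)}G_i$$ with $R_i^{(01)},R_i^{(12)}\in\mathbb{C}[x_0,x_1,x_2]$ homogeneous of degree $2n-5$. Let $W_0,W_2\in\mathcal{C}^0_1$ and $W_1\in\mathcal{C}^1_0$ be the Čech–de Rham cochains attached to $U_0,U_2,U_1$ as in the context. Define $W_{01},W_{12}\in\mathcal{C}^1_0$ (components on $\mathcal{U}_0\cap X$, $\mathcal{U}_1\cap X$, $\mathcal{U}_2\cap X$, in this order) by $$W_{01}=\Big\{\tfrac{x_1R_2^{(01)}-x_2R_1^{(01)}}{G_0^2}\Omega_0,\ \tfrac{-x_0R_2^{(01)}+x_2R_0^{(01)}}{G_1^2}\Omega_1,\ \tfrac{x_0R_1^{(01)}-x_1R_0^{(01)}}{G_2^2}\Omega_2\Big\},$$ $$W_{12}=\Big\{-\tfrac{x_1R_2^{(12)}-x_2R_1^{(12)}}{G_0^2}\Omega_0,\ -\tfrac{-x_0R_2^{(12)}+x_2R_0^{(12)}}{G_1^2}\Omega_1,\ -\tfrac{x_0R_1^{(12)}-x_1R_0^{(12)}}{G_2^2}\Omega_2\Big\}.$$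 Then $D(W_{01})=W_0\bullet W_1$ and $D(W_{12})=W_1\bullet W_2$ in $\mathcal{C}^1_1$.
   Context: The zero polynomial counts as homogeneous of every degree, and it is the only homogeneous polynomial of negative degree. Let $\mathcal{U}_i=\{x\in\mathbb{P}^2: G_i(x)\ne0\}$, $i=0,1,2$; since $X$ is smooth, $\mathcal{U}=\{\mathcal{U}_0,\mathcal{U}_1,\mathcal{U}_2\}$ is an open cover of $\mathbb{P}^2$ (the Jacobian cover). Čech–de Rham complex of $X$: $\mathcal{C}^p_q=\mathcal{C}^q(\mathcal{U}|_X,\Omega_X^p)$ is the space of Čech $q$-cochains with values in holomorphic $p$-forms on $X$ (so $\mathcal{C}^2_q=0$). The total differential is $D=d+(-1)^p\delta$ on $\mathcal{C}^p_q$, with $d$ the exterior derivative and $\delta$ the Čech differential, $(\delta\varphi)_{ij}=\varphi_j-\varphi_i$, $(\delta\varphi)_{012}=\varphi_{12}-\varphi_{02}+\varphi_{01}$. A cochain in $\mathcal{C}^p_1$ is listed by its components on $\mathcal{U}_i\cap\mathcal{U}_j\cap X$ for $(ij)=(01),(02),(12)$. Product: for $\alpha\in\mathcal{C}^p_q$, $\beta\in\mathcal{C}^r_s$, $\alpha\wedge\beta\in\mathcal{C}^{p+r}_{q+s}$ is given by $(\alpha\wedge\beta)_{i_0\cdots i_{q+s}}=\alpha_{i_0\cdots i_q}\wedge\beta_{i_q\cdots i_{q+s}}$ (front $q$-face, back $s$-face), and $\alpha\bullet\beta=(-1)^{qr}\alpha\wedge\beta$. Forms: $\Omega=x_0\,dx_1\wedge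 dx_2-x_1\,dx_0\wedge dx_2+x_2\,dx_0\wedge dx_1$. With $K_j$ the contraction with $\partial/\partial x_j$, put $\Omega_i=K_i\Omega$ and $\Omega_{ij}=K_jK_i\Omega$. Explicitly $\Omega_0=x_2dx_1-x_1dx_2$, $\Omega_1=x_0dx_2-x_2dx_0$, $\Omega_2=x_1dx_0-x_0dx_1$, $\Omega_{01}=x_2$, $\Omega_{02}=-x_1$, $\Omega_{12}=x_0$. Put $G_{ij}=G_iG_j$. Cochains attached to $U_0,U_1,U_2$: $$W_k=\Big\{\tfrac{U_k}{G_{01}}\Omega_{01},\tfrac{U_k}{G_{02}}\Omega_{02},\tfrac{U_k}{G_{12}}\Omega_{12}\Big\}\in\mathcal{C}^0_1\ (k=0,2),\qquad W_1=\Big\{\tfrac{U_1}{G_0}\Omega_0,\tfrac{U_1}{G_1}\Omega_1,\tfrac{U_1}{G_2}\Omega_2\Big\}\in\mathcal{C}^1_0,$$ all restricted to $X$. *)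

theory Defs
  imports "HOL-Analysis.Analysis" "HOL-Library.Poly_Mapping" "HOL-Combinatorics.Permutations"
begin

section \<open>Polynomials in three variables\<close>

text \<open>The variables are indexed by the three-element type \<open>3\<close>, whose elements are written
  \<open>0, 1, 2\<close> and ordered \<open>0 < 1 < 2\<close>.  (In this type the numeral \<open>3\<close> equals \<open>0\<close>.)
  The ring structure is that of finitely supported functions on monomials with the
  convolution product.\<close>

type_synonym poly3 = "(3 \<Rightarrow>\<^sub>0 nat) \<Rightarrow>\<^sub>0 complex"

definition peval :: "poly3 \<Rightarrow> complex ^ 3 \<Rightarrow> complex" where
  "peval P x = (\<Sum>m\<in>Poly_Mapping.keys P. Poly_Mapping.lookup P m *
     (\<Prod>i\<in>UNIV. (x $ i) ^ Poly_Mapping.lookup m i))"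

text \<open>In the summands with exponent \<open>0\<close> of the variable, the subtraction of exponents truncates,
  but the coefficient is \<open>0\<close>.\<close>

definition pdiff :: "3 \<Rightarrow> poly3 \<Rightarrow> poly3" where
  "pdiff i P = (\<Sum>m\<in>Poly_Mapping.keys P.
     Poly_Mapping.single (m - Poly_Mapping.single i 1)
       (Poly_Mapping.lookup P m * of_nat (Poly_Mapping.lookup m i)))"

text \<open>The degree is an integer: the zero polynomial is homogeneous of every degree, and it is
  the only one of negative degree.\<close>

definition homogeneous :: "int \<Rightarrow> poly3 \<Rightarrow> bool" where
  "homogeneous e P \<longleftrightarrow>
     (\<forall>m\<in>Poly_Mapping.keys P. int (\<Sum>i\<in>UNIV. Poly_Mapping.lookup m i) = e)"


section \<open>The projective plane, the curve and the Jacobian cover\<close>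

text \<open>A point of \<open>\<P>\<^sup>2\<close> is a punctured line through the origin of \<open>\<complex>\<^sup>3\<close>.\<close>

definition proj :: "complex ^ 3 \<Rightarrow> (complex ^ 3) set" where
  "proj x = {c *s x | c. c \<noteq> 0}"

definition proj_curve :: "poly3 \<Rightarrow> (complex ^ 3) set set" where
  "proj_curve G = {proj x | x. x \<noteq> 0 \<and> peval G x = 0}"

text \<open>The defining equation \<open>G\<close> has no singular zero (Jacobian criterion).\<close>

definition smooth_plane_curve :: "poly3 \<Rightarrow> bool" where
  "smooth_plane_curve G \<longleftrightarrow>
     (\<forall>x. x \<noteq> 0 \<longrightarrow> peval G x = 0 \<longrightarrow> (\<exists>i. peval (pdiff i G) x \<noteq> 0))"

definition jac_open :: "poly3 \<Rightarrow> 3 \<Rightarrow> (complex ^ 3) set set" where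
  "jac_open G i = {proj x | x. x \<noteq> 0 \<and> peval (pdiff i G) x \<noteq> 0}"

definition jac_inter :: "poly3 \<Rightarrow> 3 list \<Rightarrow> (complex ^ 3) set set" where
  "jac_inter G I = (\<Inter>i\<in>set I. jac_open G i) \<inter> proj_curve G"


section \<open>Differential forms on \<open>\<complex>\<^sup>3\<close>\<close>

text \<open>A \<open>p\<close>-form is evaluated at a point and a list of \<open>p\<close> vectors; its values on lists of
  other lengths are irrelevant.\<close>

type_synonym form = "complex ^ 3 \<Rightarrow> (complex ^ 3) list \<Rightarrow> complex"

definition alternating :: "nat \<Rightarrow> ((complex ^ 3) list \<Rightarrow> complex) \<Rightarrow> bool" where
  "alternating p a \<longleftrightarrow>
     (\<forall>vs i b c v w. length vs = p \<longrightarrow> i < p \<longrightarrow>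
        a (vs[i := b *s v + c *s w]) = b * a (vs[i := v]) + c * a (vs[i := w])) \<and>
     (\<forall>vs i j. length vs = p \<longrightarrow> i < j \<longrightarrow> j < p \<longrightarrow> vs ! i = vs ! j \<longrightarrow> a vs = 0)"

definition holomorphic3_on :: "(complex ^ 3 \<Rightarrow> complex) \<Rightarrow> (complex ^ 3) set \<Rightarrow> bool" where
  "holomorphic3_on f N \<longleftrightarrow>
     (\<forall>y\<in>N. \<exists>L. (f has_derivative L) (at y) \<and> (\<forall>c v. L (c *s v) = c * L v))"

definition ambient_forms :: "nat \<Rightarrow> (complex ^ 3) set \<Rightarrow> form set" where
  "ambient_forms p N = {\<alpha>. (\<forall>y\<in>N. alternating p (\<alpha> y)) \<and>
     (\<forall>vs. length vs = p \<longrightarrow> holomorphic3_on (\<lambda>y. \<alpha> y vs) N)}"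

text \<open>The exterior derivative at \<open>x\<close>, evaluated on constant vector fields.\<close>

definition omit :: "nat \<Rightarrow> 'a list \<Rightarrow> 'a list" where
  "omit k xs = take k xs @ drop (Suc k) xs"

definition ambient_d :: "form \<Rightarrow> form" where
  "ambient_d \<alpha> x vs = (\<Sum>k<length vs. (-1) ^ k *
     frechet_derivative (\<lambda>y. \<alpha> y (omit k vs)) (at x) (vs ! k))"

text \<open>The wedge product of a \<open>p\<close>-form and an \<open>r\<close>-form, normalized so that
  \<open>(dx\<^sub>i \<and> dx\<^sub>j)(v, w) = v\<^sub>i w\<^sub>j - v\<^sub>j w\<^sub>i\<close>.\<close>

definition wedge :: "nat \<Rightarrow> nat \<Rightarrow> form \<Rightarrow> form \<Rightarrow> form" where
  "wedge p r \<alpha> \<beta> x vs =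
     (\<Sum>\<sigma> | \<sigma> permutes {..<p + r}. of_int (sign \<sigma>) *
        \<alpha> x (map (\<lambda>k. vs ! \<sigma> k) [0..<p]) * \<beta> x (map (\<lambda>k. vs ! \<sigma> k) [p..<p + r]))
     / (fact p * fact r)"

definition dx :: "3 \<Rightarrow> form" where
  "dx i x vs = vs ! 0 $ i"

definition contraction :: "3 \<Rightarrow> form \<Rightarrow> form" where
  "contraction j \<alpha> x vs = \<alpha> x (axis j 1 # vs)"

definition Omega :: form where
  "Omega x vs = x $ 0 * wedge 1 1 (dx 1) (dx 2) x vs - x $ 1 * wedge 1 1 (dx 0) (dx 2) x vs
     + x $ 2 * wedge 1 1 (dx 0) (dx 1) x vs"

definition Omega1 :: "3 \<Rightarrow> form" where
  "Omega1 i = contraction i Omega"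

definition Omega2 :: "3 \<Rightarrow> 3 \<Rightarrow> form" where
  "Omega2 i j = contraction j (contraction i Omega)"


section \<open>Holomorphic forms on open subsets of the curve\<close>

text \<open>A tangent vector of \<open>\<P>\<^sup>2\<close> at \<open>[x]\<close> is represented by a pair \<open>(x, v)\<close> with \<open>x \<noteq> 0\<close>; two pairs
  represent the same vector iff they are \<open>(x, v)\<close> and \<open>(c x, c v + b x)\<close> with \<open>c \<noteq> 0\<close>.  The vector
  is tangent to the curve iff \<open>v\<close> lies in the kernel of the differential of \<open>G\<close> at \<open>x\<close>.
  A \<open>p\<close>-form on an open subset \<open>V\<close> of the curve is given by its values on these
  representatives; by convention it takes the value \<open>0\<close> outside them, so that two forms on \<open>V\<close>
  are equal iff they are equal as functions.\<close>

definition tangent :: "poly3 \<Rightarrow> complex ^ 3 \<Rightarrow> (complex ^ 3) set" where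
  "tangent G x = {v. (\<Sum>i\<in>UNIV. peval (pdiff i G) x * v $ i) = 0}"

definition frames :: "poly3 \<Rightarrow> nat \<Rightarrow> (complex ^ 3) set set \<Rightarrow>
    ((complex ^ 3) \<times> (complex ^ 3) list) set" where
  "frames G p V = {(x, vs). x \<noteq> 0 \<and> proj x \<in> V \<and> length vs = p \<and> set vs \<subseteq> tangent G x}"

definition restrict_form :: "poly3 \<Rightarrow> nat \<Rightarrow> (complex ^ 3) set set \<Rightarrow> form \<Rightarrow> form" where
  "restrict_form G p V \<alpha> x vs = (if (x, vs) \<in> frames G p V then \<alpha> x vs else 0)"

text \<open>\<open>\<alpha>\<close> is a holomorphic form on the neighbourhood \<open>N\<close> of \<open>x\<close> in \<open>\<complex>\<^sup>3\<close>
  which restricts to \<open>\<omega>\<close> on the part of the cone over \<open>V\<close> inside \<open>N\<close>.\<close>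

definition local_extension :: "poly3 \<Rightarrow> nat \<Rightarrow> (complex ^ 3) set set \<Rightarrow> form \<Rightarrow> complex ^ 3 \<Rightarrow>
    (complex ^ 3) set \<Rightarrow> form \<Rightarrow> bool" where
  "local_extension G p V \<omega> x N \<alpha> \<longleftrightarrow> open N \<and> x \<in> N \<and> \<alpha> \<in> ambient_forms p N \<and>
     (\<forall>y vs. y \<in> N \<longrightarrow> (y, vs) \<in> frames G p V \<longrightarrow> \<alpha> y vs = \<omega> y vs)"

text \<open>The second and third condition say that the form depends only on the represented tangent
  vectors of \<open>\<P>\<^sup>2\<close>; multilinearity and alternation come from the local extensions.\<close>

definition holo_forms :: "poly3 \<Rightarrow> nat \<Rightarrow> (complex ^ 3) set set \<Rightarrow> form set" where
  "holo_forms G p V = {\<omega>.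
     (\<forall>x vs. (x, vs) \<notin> frames G p V \<longrightarrow> \<omega> x vs = 0) \<and>
     (\<forall>x vs c. (x, vs) \<in> frames G p V \<longrightarrow> c \<noteq> 0 \<longrightarrow> \<omega> (c *s x) (map (\<lambda>v. c *s v) vs) = \<omega> x vs) \<and>
     (\<forall>x vs. (x, vs) \<in> frames G p V \<longrightarrow> x \<in> set vs \<longrightarrow> \<omega> x vs = 0) \<and>
     (\<forall>x. x \<noteq> 0 \<longrightarrow> proj x \<in> V \<longrightarrow> (\<exists>N \<alpha>. local_extension G p V \<omega> x N \<alpha>))}"

text \<open>The exterior derivative on the curve is the restriction of the exterior derivative of an
  arbitrary local extension.\<close>

definition curve_d :: "poly3 \<Rightarrow> nat \<Rightarrow> (complex ^ 3) set set \<Rightarrow> form \<Rightarrow> form" where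
  "curve_d G p V \<omega> x vs =
     (if (x, vs) \<in> frames G (Suc p) V
      then THE c. \<exists>N \<alpha>. local_extension G p V \<omega> x N \<alpha> \<and> c = ambient_d \<alpha> x vs
      else 0)"


section \<open>The Cech-de Rham complex of the Jacobian cover\<close>

text \<open>A \<open>q\<close>-cochain has one component for each \<open>i\<^sub>0 < \<dots> < i\<^sub>q\<close> and is \<open>0\<close> at all other index lists.
  The degrees \<open>q\<close> and \<open>p\<close> are visible as the lengths of the index list and of the list of
  vectors.  Hence cochains of different bidegrees have disjoint supports, and their pointwise sum
  is their sum in the total complex.\<close>

type_synonym cochain = "3 list \<Rightarrow> form"

definition simplices :: "nat \<Rightarrow> 3 list set" where
  "simplices q = {I. length I = Suc q \<and> sorted_wrt (<) I}"

definition CdR :: "poly3 \<Rightarrow> nat \<Rightarrow> nat \<Rightarrow> cochain set" where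
  "CdR G p q = {\<phi>. (\<forall>I\<in>simplices q. \<phi> I \<in> holo_forms G p (jac_inter G I)) \<and>
     (\<forall>I. I \<notin> simplices q \<longrightarrow> \<phi> I = (\<lambda>x vs. 0))}"

definition cech_delta :: "poly3 \<Rightarrow> nat \<Rightarrow> nat \<Rightarrow> cochain \<Rightarrow> cochain" where
  "cech_delta G p q \<phi> I = (if I \<in> simplices (Suc q)
     then restrict_form G p (jac_inter G I)
            (\<lambda>x vs. \<Sum>k<length I. (-1) ^ k * \<phi> (omit k I) x vs)
     else (\<lambda>x vs. 0))"

definition cech_d :: "poly3 \<Rightarrow> nat \<Rightarrow> nat \<Rightarrow> cochain \<Rightarrow> cochain" where
  "cech_d G p q \<phi> I = (if I \<in> simplices q then curve_d G p (jac_inter G I) (\<phi> I)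
     else (\<lambda>x vs. 0))"

definition total_D :: "poly3 \<Rightarrow> nat \<Rightarrow> nat \<Rightarrow> cochain \<Rightarrow> cochain" where
  "total_D G p q \<phi> = (\<lambda>I x vs. cech_d G p q \<phi> I x vs + (-1) ^ p * cech_delta G p q \<phi> I x vs)"

text \<open>Both products take \<open>\<alpha>\<close> of bidegree \<open>(p, q)\<close> and \<open>\<beta>\<close> of bidegree \<open>(r, s)\<close>.\<close>

definition cech_wedge :: "poly3 \<Rightarrow> nat \<Rightarrow> nat \<Rightarrow> nat \<Rightarrow> nat \<Rightarrow> cochain \<Rightarrow> cochain \<Rightarrow> cochain" where
  "cech_wedge G p q r s \<alpha> \<beta> I = (if I \<in> simplices (q + s)
     then restrict_form G (p + r) (jac_inter G I)
            (wedge p r (\<alpha> (take (Suc q) I)) (\<beta> (drop q I)))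
     else (\<lambda>x vs. 0))"

definition cech_bullet :: "poly3 \<Rightarrow> nat \<Rightarrow> nat \<Rightarrow> nat \<Rightarrow> nat \<Rightarrow> cochain \<Rightarrow> cochain \<Rightarrow> cochain" where
  "cech_bullet G p q r s \<alpha> \<beta> =
     (\<lambda>I x vs. (-1) ^ (q * r) * cech_wedge G p q r s \<alpha> \<beta> I x vs)"


section \<open>The cochains attached to polynomials\<close>

text \<open>The cochains of \<open>p\<close>-forms with the listed components, restricted to the curve.\<close>

definition cochain0 :: "poly3 \<Rightarrow> nat \<Rightarrow> form \<Rightarrow> form \<Rightarrow> form \<Rightarrow> cochain" where
  "cochain0 G p \<alpha>\<^sub>0 \<alpha>\<^sub>1 \<alpha>\<^sub>2 I =
     (if I = [0] then restrict_form G p (jac_inter G I) \<alpha>\<^sub>0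
      else if I = [1] then restrict_form G p (jac_inter G I) \<alpha>\<^sub>1
      else if I = [2] then restrict_form G p (jac_inter G I) \<alpha>\<^sub>2
      else (\<lambda>x vs. 0))"

definition cochain1 :: "poly3 \<Rightarrow> nat \<Rightarrow> form \<Rightarrow> form \<Rightarrow> form \<Rightarrow> cochain" where
  "cochain1 G p \<alpha>\<^sub>0\<^sub>1 \<alpha>\<^sub>0\<^sub>2 \<alpha>\<^sub>1\<^sub>2 I =
     (if I = [0, 1] then restrict_form G p (jac_inter G I) \<alpha>\<^sub>0\<^sub>1
      else if I = [0, 2] then restrict_form G p (jac_inter G I) \<alpha>\<^sub>0\<^sub>2
      else if I = [1, 2] then restrict_form G p (jac_inter G I) \<alpha>\<^sub>1\<^sub>2
      else (\<lambda>x vs. 0))"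

definition rat_form :: "poly3 \<Rightarrow> poly3 \<Rightarrow> form \<Rightarrow> form" where
  "rat_form P Q \<alpha> x vs = peval P x / peval Q x * \<alpha> x vs"

definition coord :: "3 \<Rightarrow> poly3" where
  "coord i = Poly_Mapping.single (Poly_Mapping.single i 1) 1"

text \<open>\<open>attached01\<close> attaches to a polynomial an element of \<open>C\<^sup>0\<^sub>1\<close>, and \<open>attached10\<close> one of \<open>C\<^sup>1\<^sub>0\<close>.\<close>

definition attached01 :: "poly3 \<Rightarrow> poly3 \<Rightarrow> cochain" where
  "attached01 G U = cochain1 G 0
     (rat_form U (pdiff 0 G * pdiff 1 G) (Omega2 0 1))
     (rat_form U (pdiff 0 G * pdiff 2 G) (Omega2 0 2))
     (rat_form U (pdiff 1 G * pdiff 2 G) (Omega2 1 2))"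

definition attached10 :: "poly3 \<Rightarrow> poly3 \<Rightarrow> cochain" where
  "attached10 G U = cochain0 G 1
     (rat_form U (pdiff 0 G) (Omega1 0))
     (rat_form U (pdiff 1 G) (Omega1 1))
     (rat_form U (pdiff 2 G) (Omega1 2))"


section \<open>Explicit formulas\<close>

lemma index3_lt: "(0::3) < 1" "(0::3) < 2" "(1::3) < 2"
  by (simp_all add: less_bit1_def bit1.Rep_0 bit1.Rep_1 bit1.Rep_numeral)

lemma index3_neq: "(0::3) \<noteq> 1" "(0::3) \<noteq> 2" "(1::3) \<noteq> 2"
  using index3_lt by auto

lemma UNIV_index3: "(UNIV :: 3 set) = {0, 1, 2}"
  using UNIV_3 by (auto simp: insert_commute)

lemma peval_coord: "peval (coord i) x = x $ i"
proof -
  have "(\<Prod>j\<in>UNIV. (x $ j) ^ Poly_Mapping.lookup (Poly_Mapping.single i 1) j)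
      = (\<Prod>j\<in>UNIV. if j = i then x $ j else 1)"
    by (rule prod.cong) (auto simp: lookup_single when_def)
  then show ?thesis
    by (simp add: peval_def coord_def)
qed

lemma wedge_01: "wedge 0 1 \<alpha> \<beta> x [v] = \<alpha> x [] * \<beta> x [v]"
  by (simp add: wedge_def lessThan_Suc permutes_sing)

lemma wedge_10: "wedge 1 0 \<alpha> \<beta> x [v] = \<alpha> x [v] * \<beta> x []"
  by (simp add: wedge_def lessThan_Suc permutes_sing)

lemma permutes_2: "{\<sigma>. \<sigma> permutes {..<1 + (1::nat)}} = {id, Transposition.transpose 0 1}"
  by (auto simp: numeral_2_eq_2 lessThan_Suc insert_commute permutes_doubleton_iff)

lemma tr_neq: "id \<noteq> Transposition.transpose (0::nat) 1"
  by (metis id_apply transpose_apply_first zero_neq_one)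

lemma wedge_11: "wedge 1 1 \<alpha> \<beta> x [v, w] = \<alpha> x [v] * \<beta> x [w] - \<alpha> x [w] * \<beta> x [v]"
  unfolding wedge_def permutes_2 using tr_neq by (simp add: sign_swap_id)

lemma Omega1_explicit:
  "Omega1 0 x [v] = x $ 2 * v $ 1 - x $ 1 * v $ 2"
  "Omega1 1 x [v] = x $ 0 * v $ 2 - x $ 2 * v $ 0"
  "Omega1 2 x [v] = x $ 1 * v $ 0 - x $ 0 * v $ 1"
  using index3_neq
  by (simp_all add: Omega1_def contraction_def Omega_def wedge_11[simplified] dx_def axis_def algebra_simps)

lemma Omega2_explicit:
  "Omega2 0 1 x [] = x $ 2"
  "Omega2 0 2 x [] = - x $ 1"
  "Omega2 1 2 x [] = x $ 0"
  using index3_neq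
  by (simp_all add: Omega2_def contraction_def Omega_def wedge_11[simplified] dx_def axis_def)

lemma cech_delta_0:
  assumes "i < j" "(x, vs) \<in> frames G p (jac_inter G [i, j])"
  shows "cech_delta G p 0 \<phi> [i, j] x vs = \<phi> [j] x vs - \<phi> [i] x vs"
  using assms by (simp add: cech_delta_def simplices_def restrict_form_def omit_def)

lemma cech_delta_1:
  assumes "(x, vs) \<in> frames G p (jac_inter G [0, 1, 2])"
  shows "cech_delta G p 1 \<phi> [0, 1, 2] x vs =
    \<phi> [1, 2] x vs - \<phi> [0, 2] x vs + \<phi> [0, 1] x vs"
  using assms index3_lt
  by (simp add: cech_delta_def simplices_def restrict_form_def omit_def lessThan_Suc)

lemma simplices_1: "simplices 1 = {[0, 1], [0, 2], [1, 2]}"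
proof -
  have *: "i = 0 \<or> i = 1 \<or> i = 2" for i :: 3
    using UNIV_index3 by blast
  have "i = 0 \<and> j = 1 \<or> i = 0 \<and> j = 2 \<or> i = 1 \<and> j = 2" if "i < j" for i j :: 3
    using that *[of i] *[of j] index3_lt by (auto dest: order.asym)
  then show ?thesis
    using index3_lt by (fastforce simp: simplices_def length_Suc_conv)
qed

lemma cech_bullet_01_10:
  assumes "i < j" "(x, [v]) \<in> frames G 1 (jac_inter G [i, j])"
  shows "cech_bullet G 0 1 1 0 \<alpha> \<beta> [i, j] x [v] = - (\<alpha> [i, j] x [] * \<beta> [j] x [v])"
  using assms wedge_01[of "\<alpha> [i, j]" "\<beta> [j]" x v]
  by (simp add: cech_bullet_def cech_wedge_def simplices_def restrict_form_def)

lemma cech_bullet_10_01: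
  assumes "i < j" "(x, [v]) \<in> frames G 1 (jac_inter G [i, j])"
  shows "cech_bullet G 1 0 0 1 \<alpha> \<beta> [i, j] x [v] = \<alpha> [i] x [v] * \<beta> [i, j] x []"
  using assms wedge_10[of "\<alpha> [i]" "\<beta> [i, j]" x v]
  by (simp add: cech_bullet_def cech_wedge_def simplices_def restrict_form_def)

end

theory Submission
  imports Defs
begin

text \<open>Write \<open>R \<cdot> \<nabla>G\<close> for \<open>\<Sum>\<^sub>k R\<^sub>k G\<^sub>k\<close>. The coefficients of \<open>W\<^sub>0\<^sub>1\<close> are the components \<open>A\<^sub>i\<close> of \<open>x \<times> R\<close>, so on the
  cone, where \<open>x \<cdot> \<nabla>G = 0\<close> by Euler's identity, \<open>A\<^sub>j G\<^sub>i - A\<^sub>i G\<^sub>j = (R \<cdot> \<nabla>G) \<Omega>\<^sub>i\<^sub>j\<close>. On tangent vectors the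
  quotients \<open>\<Omega>\<^sub>i / G\<^sub>i\<close> do not depend on \<open>i\<close>, which turns this identity into the value of the Cech
  differential. The exterior derivative contributes nothing: the tangent plane of the cone at \<open>x\<close>
  contains \<open>x\<close>, and \<open>d\<alpha>(x, u) = 0\<close> for every extension \<open>\<alpha>\<close> of a form on the curve.\<close>

section \<open>Polynomials as functions\<close>

lemma sum_index3: "(\<Sum>i\<in>UNIV. f i) = f (0::3) + f 1 + f 2" for f :: "3 \<Rightarrow> 'a::comm_monoid_add"
  unfolding UNIV_index3 using index3_neq by (simp add: add.assoc)

lemma index3_cases: "i = 0 \<or> i = 1 \<or> i = (2::3)"
  using UNIV_index3 by blast

definition monom_val :: "complex ^ 3 \<Rightarrow> (3 \<Rightarrow>\<^sub>0 nat) \<Rightarrow> complex" where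
  "monom_val x m = (\<Prod>i\<in>UNIV. (x $ i) ^ Poly_Mapping.lookup m i)"

text \<open>The support of a sum may be smaller than the union of the supports; summing over a
  common finite superset makes evaluation visibly additive.\<close>

lemma peval_superset:
  assumes "finite S" "Poly_Mapping.keys P \<subseteq> S"
  shows "peval P x = (\<Sum>m\<in>S. Poly_Mapping.lookup P m * monom_val x m)"
  unfolding peval_def monom_val_def[symmetric]
  using assms by (intro sum.mono_neutral_left) (auto simp: in_keys_iff)

lemma peval_zero [simp]: "peval 0 x = 0"
  by (simp add: peval_def)

lemma peval_single: "peval (Poly_Mapping.single m c) x = c * monom_val x m"
  by (subst peval_superset[of "{m}"]) auto

lemma peval_add: "peval (P + Q) x = peval P x + peval Q x"
proof -
  let ?S = "Poly_Mapping.keys P \<union> Poly_Mapping.keys Q"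
  have "Poly_Mapping.keys (P + Q) \<subseteq> ?S"
    by (rule Poly_Mapping.keys_add)
  then show ?thesis
    by (simp add: peval_superset[of ?S] lookup_add distrib_right sum.distrib)
qed

lemma peval_uminus: "peval (- P) x = - peval P x"
  using peval_add[of P "- P" x] by (simp add: eq_neg_iff_add_eq_0 add.commute)

lemma peval_diff: "peval (P - Q) x = peval P x - peval Q x"
  using peval_add[of P "- Q" x] by (simp add: peval_uminus)

lemma peval_sum: "peval (\<Sum>i\<in>I. P i) x = (\<Sum>i\<in>I. peval (P i) x)"
  by (induction I rule: infinite_finite_induct) (auto simp: peval_add)

lemma poly3_eq_sum_single:
  "P = (\<Sum>m\<in>Poly_Mapping.keys P. Poly_Mapping.single m (Poly_Mapping.lookup P m))" for P :: poly3
  by (rule poly_mapping_eqI)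
    (simp add: lookup_sum lookup_single when_def sum.delta' in_keys_iff)

lemma monom_val_add: "monom_val x (m + m') = monom_val x m * monom_val x m'"
  by (simp add: monom_val_def lookup_add power_add prod.distrib)

lemma peval_mult: "peval (P * Q) x = peval P x * peval Q x"
proof -
  have "P * Q = (\<Sum>m\<in>Poly_Mapping.keys P. \<Sum>m'\<in>Poly_Mapping.keys Q.
      Poly_Mapping.single (m + m') (Poly_Mapping.lookup P m * Poly_Mapping.lookup Q m'))"
    by (subst poly3_eq_sum_single[of P], subst poly3_eq_sum_single[of Q])
      (simp add: sum_product mult_single)
  also have "peval \<dots> x = peval P x * peval Q x"
    by (simp add: peval_sum peval_single monom_val_add peval_def[of P, folded monom_val_def] 
      peval_def[of Q, folded monom_val_def] sum_product mult_ac)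
  finally show ?thesis .
qed

section \<open>Formal partial derivatives as analytic derivatives\<close>

lemma peval_pdiff:
  "peval (pdiff i P) x = (\<Sum>m\<in>Poly_Mapping.keys P. Poly_Mapping.lookup P m *
     (of_nat (Poly_Mapping.lookup m i) * monom_val x (m - Poly_Mapping.single i 1)))"
  by (simp add: pdiff_def peval_sum peval_single mult_ac)

text \<open>Truncated subtraction is harmless: at exponent 0 both sides use exponent 0 again, and
  each use below multiplies by that exponent.\<close>

lemma monom_val_minus_single:
  "monom_val x (m - Poly_Mapping.single i 1) =
     (x $ i) ^ (Poly_Mapping.lookup m i - 1) * (\<Prod>j\<in>UNIV - {i}. (x $ j) ^ Poly_Mapping.lookup m j)"
  unfolding monom_val_def
  by (subst prod.remove[of UNIV i]) (auto simp: lookup_minus lookup_single intro!: prod.cong)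

lemma has_derivative_peval:
  "((\<lambda>y. peval P y) has_derivative (\<lambda>v. \<Sum>i\<in>UNIV. peval (pdiff i P) x * v $ i)) (at x)"
proof -
  have "(monom_val' has_derivative
      (\<lambda>v. \<Sum>i\<in>UNIV. of_nat (Poly_Mapping.lookup m i) * monom_val x (m - Poly_Mapping.single i 1) * v $ i))
      (at x)" if "monom_val' = (\<lambda>y. monom_val y m)" for m monom_val'
  proof -
    have *: "((\<lambda>y. (y $ i) ^ Poly_Mapping.lookup m i) has_derivative
        (\<lambda>v. of_nat (Poly_Mapping.lookup m i) * (v $ i) * (x $ i) ^ (Poly_Mapping.lookup m i - 1))) (at x)" for i :: 3
      by (rule has_derivative_power[OF bounded_linear.has_derivative[OF bounded_linear_vec_nth has_derivative_ident]])
    show ?thesis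
      unfolding that unfolding monom_val_def[of _ m, abs_def]
      by (rule has_derivative_eq_rhs, rule has_derivative_prod, rule *)
        (auto simp: monom_val_minus_single[unfolded One_nat_def] mult_ac)
  qed
  then have "((\<lambda>y. \<Sum>m\<in>Poly_Mapping.keys P. Poly_Mapping.lookup P m * monom_val y m) has_derivative
      (\<lambda>v. \<Sum>m\<in>Poly_Mapping.keys P. Poly_Mapping.lookup P m *
        (\<Sum>i\<in>UNIV. of_nat (Poly_Mapping.lookup m i) * monom_val x (m - Poly_Mapping.single i 1) * v $ i)))
      (at x)"
    by (intro has_derivative_sum has_derivative_mult_right) auto
  then have "(peval P has_derivative
      (\<lambda>v. \<Sum>m\<in>Poly_Mapping.keys P. Poly_Mapping.lookup P m *
        (\<Sum>i\<in>UNIV. of_nat (Poly_Mapping.lookup m i) * monom_val x (m - Poly_Mapping.single i 1) * v $ i)))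
      (at x)"
    by (simp only: peval_def[abs_def, folded monom_val_def])
  then show ?thesis
  proof (rule has_derivative_eq_rhs, intro ext)
    fix v :: "complex ^ 3"
    show "(\<Sum>m\<in>Poly_Mapping.keys P. Poly_Mapping.lookup P m *
        (\<Sum>i\<in>UNIV. of_nat (Poly_Mapping.lookup m i) * monom_val x (m - Poly_Mapping.single i 1) * v $ i))
      = (\<Sum>i\<in>UNIV. peval (pdiff i P) x * v $ i)"
      unfolding peval_pdiff sum_distrib_left sum_distrib_right
      by (subst sum.swap) (simp only: mult.assoc)
  qed
qed

lemma continuous_on_peval [continuous_intros]: "continuous_on S (peval P)"
  by (intro continuous_at_imp_continuous_on ballI has_derivative_continuous[OF has_derivative_peval])

lemma open_peval_neq_0: "open {y. peval Q y \<noteq> 0}"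
  by (intro open_Collect_neq continuous_on_peval continuous_on_const)

section \<open>Homogeneity and Euler's identity\<close>

lemma monom_val_scale:
  "monom_val (c *s x) m = c ^ (\<Sum>i\<in>UNIV. Poly_Mapping.lookup m i) * monom_val x m"
  by (simp add: monom_val_def power_mult_distrib prod.distrib power_sum)

lemma peval_scale:
  assumes "homogeneous e P" "c \<noteq> 0"
  shows "peval P (c *s x) = c powi e * peval P x"
proof -
  have "c ^ (\<Sum>i\<in>UNIV. Poly_Mapping.lookup m i) = c powi e" if "m \<in> Poly_Mapping.keys P" for m
    using assms(1) that by (metis homogeneous_def power_int_of_nat)
  then show ?thesis
    by (simp add: peval_def[folded monom_val_def] monom_val_scale sum_distrib_left mult_ac
        cong: sum.cong)
qed

lemma homogeneous_pdiff:
  assumes "homogeneous e P"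
  shows "homogeneous (e - 1) (pdiff i P)"
  unfolding homogeneous_def
proof
  fix k assume "k \<in> Poly_Mapping.keys (pdiff i P)"
  then obtain m where m: "m \<in> Poly_Mapping.keys P"
      "k \<in> Poly_Mapping.keys (Poly_Mapping.single (m - Poly_Mapping.single i 1)
        (Poly_Mapping.lookup P m * of_nat (Poly_Mapping.lookup m i)))"
    unfolding pdiff_def using keys_sum[THEN subsetD] by (metis (no_types, lifting) UN_E)
  \<comment> \<open>A monomial free of the variable gets coefficient 0 in \<open>pdiff\<close>, so
    for a surviving key the subtraction of exponents is exact.\<close>
  then have k: "k = m - Poly_Mapping.single i 1" and "Poly_Mapping.lookup m i \<noteq> 0"
    by (simp_all split: if_splits)
  then have "Poly_Mapping.lookup m j = Poly_Mapping.lookup k j + (if j = i then 1 else 0)" for j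
    by (simp add: lookup_minus lookup_single when_def)
  then have "(\<Sum>j\<in>UNIV. Poly_Mapping.lookup m j) = (\<Sum>j\<in>UNIV. Poly_Mapping.lookup k j) + 1"
    by (simp add: sum.distrib)
  moreover have "int (\<Sum>j\<in>UNIV. Poly_Mapping.lookup m j) = e"
    using assms m(1) unfolding homogeneous_def by blast
  ultimately show "int (\<Sum>j\<in>UNIV. Poly_Mapping.lookup k j) = e - 1"
    by linarith
qed

lemma euler_identity:
  assumes "homogeneous e P"
  shows "(\<Sum>i\<in>UNIV. peval (pdiff i P) x * x $ i) = of_int e * peval P x"
proof -
  \<comment> \<open>Multiplying by the variable restores the monomial; at exponent 0 the factor
    \<open>of_nat\<close> kills both sides.\<close>
  have *: "of_nat (Poly_Mapping.lookup m i) * monom_val x (m - Poly_Mapping.single i 1) * x $ i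
      = of_nat (Poly_Mapping.lookup m i) * monom_val x m" for m i
    unfolding monom_val_minus_single
    unfolding monom_val_def prod.remove[of UNIV i, OF finite_class.finite_UNIV UNIV_I]
    by (cases "Poly_Mapping.lookup m i") auto
  have "(\<Sum>i\<in>UNIV. peval (pdiff i P) x * x $ i)
      = (\<Sum>i\<in>UNIV. \<Sum>m\<in>Poly_Mapping.keys P. Poly_Mapping.lookup P m *
           (of_nat (Poly_Mapping.lookup m i) * monom_val x m))"
    unfolding peval_pdiff sum_distrib_right mult.assoc[of "Poly_Mapping.lookup P _"] * ..
  also have "\<dots> = (\<Sum>m\<in>Poly_Mapping.keys P. Poly_Mapping.lookup P m *
           (of_nat (\<Sum>i\<in>UNIV. Poly_Mapping.lookup m i) * monom_val x m))"
    by (subst sum.swap) (simp add: sum_distrib_left sum_distrib_right)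
  also have "\<dots> = (\<Sum>m\<in>Poly_Mapping.keys P. Poly_Mapping.lookup P m * (of_int e * monom_val x m))"
  proof (intro sum.cong refl)
    fix m assume "m \<in> Poly_Mapping.keys P"
    then have "int (\<Sum>i\<in>UNIV. Poly_Mapping.lookup m i) = e"
      using assms unfolding homogeneous_def by blast
    then have "(of_nat (\<Sum>i\<in>UNIV. Poly_Mapping.lookup m i) :: complex) = of_int e"
      by (metis of_int_of_nat_eq)
    then show "Poly_Mapping.lookup P m *
        (of_nat (\<Sum>i\<in>UNIV. Poly_Mapping.lookup m i) * monom_val x m) =
        Poly_Mapping.lookup P m * (of_int e * monom_val x m)"
      by (simp only:)
  qed
  also have "\<dots> = of_int e * peval P x"
    by (simp add: peval_def[folded monom_val_def] sum_distrib_left mult_ac)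
  finally show ?thesis .
qed

lemma homogeneous_mult:
  assumes "homogeneous d P" "homogeneous e Q"
  shows "homogeneous (d + e) (P * Q)"
  unfolding homogeneous_def
proof
  fix m assume "m \<in> Poly_Mapping.keys (P * Q)"
  then obtain a b where "m = a + b" "a \<in> Poly_Mapping.keys P" "b \<in> Poly_Mapping.keys Q"
    using keys_mult[of P Q] by blast
  with assms show "int (\<Sum>i\<in>UNIV. Poly_Mapping.lookup m i) = d + e"
    by (simp add: homogeneous_def lookup_add sum.distrib)
qed

lemma homogeneous_add:
  "homogeneous e P \<Longrightarrow> homogeneous e Q \<Longrightarrow> homogeneous e (P + Q)"
  using Poly_Mapping.keys_add[of P Q] by (auto simp: homogeneous_def)

lemma homogeneous_uminus: "homogeneous e P \<Longrightarrow> homogeneous e (- P)"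
  by (simp add: homogeneous_def)

lemma homogeneous_diff:
  "homogeneous e P \<Longrightarrow> homogeneous e Q \<Longrightarrow> homogeneous e (P - Q)"
  using homogeneous_add[of e P "- Q"] by (simp add: homogeneous_uminus)

lemma homogeneous_coord: "homogeneous 1 (coord i)"
  by (auto simp: homogeneous_def coord_def lookup_single when_def)

section \<open>Curves on the zero set\<close>

lemma tangent_iff:
  "v \<in> tangent G x \<longleftrightarrow> peval (pdiff 0 G) x * v $ 0 + peval (pdiff 1 G) x * v $ 1 + peval (pdiff 2 G) x * v $ 2 = 0"
  by (simp add: tangent_def sum_index3)

lemma euler_tangent:
  assumes "homogeneous e G" "peval G x = 0"
  shows "x \<in> tangent G x"
  using euler_identity[OF assms(1), of x] assms(2) by (simp add: tangent_def)

text \<open>By the inverse function theorem the zero set is smooth at x, so each tangent vector is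
  the velocity of a real curve inside it. This allows differentiating identities that hold only on
  the cone.\<close>

lemma zero_set_curve:
  assumes Gx: "peval G x = 0" and Gi: "peval (pdiff i G) x \<noteq> 0" and u: "u \<in> tangent G x"
  obtains \<gamma> :: "real \<Rightarrow> complex ^ 3"
  where "\<gamma> 0 = x" "(\<gamma> has_vector_derivative u) (at 0)" "\<forall>\<^sub>F t in nhds 0. peval G (\<gamma> t) = 0"
proof -
  \<comment> \<open>\<open>\<Phi>\<close> replaces the \<open>i\<close>-th coordinate by \<open>G\<close>; it is a local coordinate system straightening the zero set.\<close>
  define \<Phi> where "\<Phi> y = y + (peval G y - y $ i) *s axis i 1" for y :: "complex ^ 3"
  define \<Phi>' where "\<Phi>' y v = v + ((\<Sum>k\<in>UNIV. peval (pdiff k G) y * v $ k) - v $ i) *s axis i 1"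
    for y v :: "complex ^ 3"
  have bl_s: "bounded_linear (\<lambda>c::complex. c *s (axis i 1 :: complex ^ 3))"
    by (intro linear_conv_bounded_linear[THEN iffD1] linearI)
      (auto simp: vec_eq_iff algebra_simps axis_def)
  have der: "(\<Phi> has_derivative \<Phi>' y) (at y)" for y
    unfolding \<Phi>_def[abs_def] \<Phi>'_def[abs_def]
    by (intro has_derivative_add has_derivative_ident bounded_linear.has_derivative[OF bl_s]
        has_derivative_diff has_derivative_peval bounded_linear.has_derivative[OF bounded_linear_vec_nth])
  then have bl: "bounded_linear (\<Phi>' y)" for y
    by (rule has_derivative_bounded_linear)
  let ?g = "peval (pdiff i G) x"
  \<comment> \<open>The solution v of \<open>\<Phi>' x v = w\<close>: only coordinate i changes, to
    (w_i - sum of g_k w_k over k \<noteq> i) / g_i. The summand \<open>?g * w $ i\<close> cancels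
    the term k = i of the full sum.\<close>
  define \<Psi> where "\<Psi> w = w + ((w $ i - (\<Sum>k\<in>UNIV. peval (pdiff k G) x * w $ k) + ?g * w $ i) / ?g - w $ i) *s axis i 1"
    for w :: "complex ^ 3"
  have bl\<Psi>: "bounded_linear \<Psi>"
    unfolding \<Psi>_def
    by (intro linear_conv_bounded_linear[THEN iffD1] linearI)
      (use Gi in \<open>auto simp: vec_eq_iff axis_def sum_index3 scaleR_conv_of_real[where 'a=complex] field_simps\<close>)
  have \<Psi>\<Phi>: "\<Psi> (\<Phi>' x v) = v" for v
  proof -
    have *: "(\<Sum>k\<in>UNIV. peval (pdiff k G) x * (\<Phi>' x v) $ k) =
        (\<Sum>k\<in>UNIV. peval (pdiff k G) x * v $ k)
          + ?g * ((\<Sum>k\<in>UNIV. peval (pdiff k G) x * v $ k) - v $ i)"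
      using index3_cases[of i] index3_neq
      by (auto simp: \<Phi>'_def axis_def sum_index3 algebra_simps)
    have **: "\<Phi>' x v $ i = (\<Sum>k\<in>UNIV. peval (pdiff k G) x * v $ k)"
      by (simp add: \<Phi>'_def axis_def)
    show ?thesis
      unfolding \<Psi>_def * ** using Gi
      by (auto simp: \<Phi>'_def axis_def vec_eq_iff field_simps)
  qed
  have comp: "Blinfun \<Psi> o\<^sub>L Blinfun (\<Phi>' x) = id_blinfun"
    by (rule blinfun_eqI) (simp add: bounded_linear_Blinfun_apply bl bl\<Psi> \<Psi>\<Phi>)
  have cont: "continuous_on UNIV (\<lambda>y. Blinfun (\<Phi>' y))"
    by (rule continuous_on_blinfun_componentwise)
      (auto simp: bounded_linear_Blinfun_apply bl \<Phi>'_def vector_scalar_mult_def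
        intro!: continuous_intros)
  have derB: "(\<Phi> has_derivative blinfun_apply (Blinfun (\<Phi>' y))) (at y)" for y
    using der by (simp add: bounded_linear_Blinfun_apply bl)
  obtain U' V h h' where "open U'" "U' \<subseteq> UNIV" and U': "x \<in> U'"
    and V: "open V" "\<Phi> x \<in> V" and hom: "homeomorphism U' V \<Phi> h"
    and h: "\<And>y. y \<in> V \<Longrightarrow> (h has_derivative h' y) (at y)"
    and h': "\<And>y. y \<in> V \<Longrightarrow> h' y = inv (blinfun_apply (Blinfun (\<Phi>' (h y))))"
    and bij: "\<And>y. y \<in> V \<Longrightarrow> bij (blinfun_apply (Blinfun (\<Phi>' (h y))))"
  proof (rule inverse_function_theorem[OF open_UNIV derB cont UNIV_I comp], goal_cases)
    case (1 U' V h h')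
    show ?case by (rule 1(1)[OF 1(2-)])
  qed
  have hx: "h (\<Phi> x) = x"
    using hom U' by (simp add: homeomorphism_def)
  have h'x: "h' (\<Phi> x) (\<Phi>' x u) = u"
    using h'[OF V(2)] bij[OF V(2)] by (simp add: hx bounded_linear_Blinfun_apply bl bij_is_inj)
  \<comment> \<open>In the straightened coordinates the curve is a line. Its i-th coordinate, which
    is the value of G, stays 0 because G vanishes at x and u is tangent.\<close>
  define L where "L t = \<Phi> x + t *\<^sub>R \<Phi>' x u" for t :: real
  have L: "(L has_derivative (\<lambda>t. t *\<^sub>R \<Phi>' x u)) (at 0)"
    unfolding L_def by (auto intro!: derivative_eq_intros)
  have Li: "L t $ i = 0" for t
    using u Gx by (simp add: L_def \<Phi>_def \<Phi>'_def tangent_def axis_def)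
  show ?thesis
  proof
    show "(h \<circ> L) 0 = x"
      by (simp add: L_def hx)
    have "(h has_derivative h' (\<Phi> x)) (at (L 0))"
      using h[OF V(2)] by (simp add: L_def)
    from has_derivative_compose[OF L this]
    show "((h \<circ> L) has_vector_derivative u) (at 0)"
      using has_derivative_bounded_linear[OF h[OF V(2)]]
      by (simp add: has_vector_derivative_def o_def linear_simps h'x)
    have "open (L -` V)"
      unfolding L_def by (intro open_vimage V continuous_intros)
    moreover have "0 \<in> L -` V"
      using V by (simp add: L_def)
    ultimately have "\<forall>\<^sub>F t in nhds 0. t \<in> L -` V"
      by (rule eventually_nhds_in_open)
    then show "\<forall>\<^sub>F t in nhds 0. peval G ((h \<circ> L) t) = 0"
    proof eventually_elim
      case (elim t)
      then have "\<Phi> (h (L t)) = L t"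
        using hom by (simp add: homeomorphism_def)
      moreover have "\<Phi> y $ i = peval G y" for y
        by (simp add: \<Phi>_def axis_def)
      ultimately show ?case
        using Li[of t] by (metis comp_apply)
    qed
  qed
qed

text \<open>A bilinear alternating form \<open>b \<cdot> (v \<times> w)\<close> on \<open>\<complex>\<^sup>3\<close> vanishes on the plane orthogonal to \<open>g\<close> iff \<open>b \<cdot> g = 0\<close>,
  and \<open>x \<times> (e\<^sub>k \<times> g) = - x\<^sub>k g\<close> for \<open>x\<close> in this plane. Hence it suffices to test the pairs \<open>(x, u)\<close>.\<close>

lemma alternating_on_plane_eq_0:
  fixes F :: "complex ^ 3 \<Rightarrow> complex ^ 3 \<Rightarrow> complex"
  assumes F: "\<And>v w. F v w = (\<Sum>i\<in>UNIV. \<Sum>j\<in>UNIV. a i j * v $ i * w $ j)"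
    and T: "\<And>u. u \<in> T \<longleftrightarrow> g 0 * u $ 0 + g 1 * u $ 1 + g 2 * u $ 2 = 0"
    and x: "x \<in> T" "x \<noteq> 0" and g: "g (i::3) \<noteq> 0"
    and alt: "\<And>u. u \<in> T \<Longrightarrow> F u x = F x u"
    and vw: "v \<in> T" "w \<in> T"
  shows "F w v = F v w"
proof -
  \<comment> \<open>(b0, b1, b2) is the vector dual to the antisymmetric part of \<open>a\<close>,
    so that F v w - F w v = b \<cdot> (v \<times> w).\<close>
  define b0 where "b0 = a 1 2 - a 2 1"
  define b1 where "b1 = a 2 0 - a 0 2"
  define b2 where "b2 = a 0 1 - a 1 0"
  have B: "F v w - F w v = b0 * (v $ 1 * w $ 2 - v $ 2 * w $ 1) + b1 * (v $ 2 * w $ 0 - v $ 0 * w $ 2)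
     + b2 * (v $ 0 * w $ 1 - v $ 1 * w $ 0)" for v w
    by (simp add: F sum_index3 b0_def b1_def b2_def algebra_simps)
  define bg where "bg = b0 * g 0 + b1 * g 1 + b2 * g 2"
  note neq = index3_neq index3_neq[symmetric]
  have "x $ k * bg = 0" for k
  proof -
    \<comment> \<open>\<open>u\<close> is the cross product of the k-th unit vector with g, written
      out for each k.\<close>
    obtain u :: "complex ^ 3" where u: 
      "k = 0 \<longrightarrow> u $ 0 = 0 \<and> u $ 1 = - g 2 \<and> u $ 2 = g 1"
      "k = 1 \<longrightarrow> u $ 0 = g 2 \<and> u $ 1 = 0 \<and> u $ 2 = - g 0"
      "k = 2 \<longrightarrow> u $ 0 = - g 1 \<and> u $ 1 = g 0 \<and> u $ 2 = 0"
    proof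
      let ?u = "\<chi> j::3. if k = 0 then (if j = 0 then 0 else if j = 1 then - g 2 else g 1)
         else if k = 1 then (if j = 0 then g 2 else if j = 1 then 0 else - g 0)
         else (if j = 0 then - g 1 else if j = 1 then g 0 else 0)"
      show "k = 0 \<longrightarrow> ?u $ 0 = 0 \<and> ?u $ 1 = - g 2 \<and> ?u $ 2 = g 1"
        "k = 1 \<longrightarrow> ?u $ 0 = g 2 \<and> ?u $ 1 = 0 \<and> ?u $ 2 = - g 0"
        "k = 2 \<longrightarrow> ?u $ 0 = - g 1 \<and> ?u $ 1 = g 0 \<and> ?u $ 2 = 0"
        using neq by auto
    qed
    have "u \<in> T"
      using u index3_cases[of k] neq by (auto simp: T)
    then have "F x u - F u x = 0"
      using alt by simp
    moreover have "g 0 * x $ 0 + g 1 * x $ 1 + g 2 * x $ 2 = 0"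
      using x T by simp
    ultimately have "u $ 0 = 0 \<and> u $ 1 = - g 2 \<and> u $ 2 = g 1 \<longrightarrow> x $ 0 * bg = 0"
        "u $ 0 = g 2 \<and> u $ 1 = 0 \<and> u $ 2 = - g 0 \<longrightarrow> x $ 1 * bg = 0"
        "u $ 0 = - g 1 \<and> u $ 1 = g 0 \<and> u $ 2 = 0 \<longrightarrow> x $ 2 * bg = 0"
      unfolding B bg_def by algebra+
    with u index3_cases[of k] show ?thesis
      by blast
  qed
  then have bg: "bg = 0"
    using x(2) by (auto simp: vec_eq_iff)
  have vw': "g 0 * v $ 0 + g 1 * v $ 1 + g 2 * v $ 2 = 0" "g 0 * w $ 0 + g 1 * w $ 1 + g 2 * w $ 2 = 0"
    using vw T by auto
  \<comment> \<open>v \<times> w is parallel to g, so g_k (b \<cdot> (v \<times> w)) equals the k-th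
    component of v \<times> w times b \<cdot> g = 0.\<close>
  have "g 0 * (F v w - F w v) = 0" "g 1 * (F v w - F w v) = 0" "g 2 * (F v w - F w v) = 0"
    unfolding B using vw' bg[unfolded bg_def] by algebra+
  then show ?thesis
    using g index3_cases[of i] by auto
qed

section \<open>The exterior derivative of a 1-form on the curve\<close>

lemma proj_scale: "c \<noteq> 0 \<Longrightarrow> proj (c *s x) = proj x"
proof -
  assume c: "c \<noteq> 0"
  have "\<exists>b. a *s x = b *s (c *s x) \<and> b \<noteq> 0" if "a \<noteq> 0" for a
    using that c by (intro exI[of _ "a / c"]) simp
  then show ?thesis
    using c by (auto simp: proj_def)
qed

text \<open>\<open>jac_open\<close> asks for some representative with nonzero partial derivative;
  homogeneity transfers this to every representative.\<close>

lemma mem_jac_open: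
  assumes "homogeneous e G" "x \<noteq> 0"
  shows "proj x \<in> jac_open G i \<longleftrightarrow> peval (pdiff i G) x \<noteq> 0"
proof
  assume "proj x \<in> jac_open G i"
  then obtain y where y: "proj x = proj y" "peval (pdiff i G) y \<noteq> 0"
    by (auto simp: jac_open_def)
  have "x \<in> proj x"
    by (force simp: proj_def intro: exI[of _ 1])
  then obtain c where "x = c *s y" "c \<noteq> 0"
    using y(1) by (auto simp: proj_def)
  then show "peval (pdiff i G) x \<noteq> 0"
    using y(2) by (simp add: peval_scale[OF homogeneous_pdiff[OF assms(1)]])
qed (use assms in \<open>auto simp: jac_open_def\<close>)

lemma mem_proj_curve:
  assumes "homogeneous e G" "x \<noteq> 0"
  shows "proj x \<in> proj_curve G \<longleftrightarrow> peval G x = 0"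
proof
  assume "proj x \<in> proj_curve G"
  then obtain y where y: "proj x = proj y" "peval G y = 0"
    by (auto simp: proj_curve_def)
  have "x \<in> proj x"
    by (force simp: proj_def intro: exI[of _ 1])
  then obtain c where "x = c *s y" "c \<noteq> 0"
    using y(1) by (auto simp: proj_def)
  then show "peval G x = 0"
    using y(2) by (simp add: peval_scale[OF assms(1)])
qed (use assms in \<open>auto simp: proj_curve_def\<close>)

lemma mem_jac_inter:
  assumes "homogeneous e G" "x \<noteq> 0"
  shows "proj x \<in> jac_inter G I \<longleftrightarrow> peval G x = 0 \<and> (\<forall>i\<in>set I. peval (pdiff i G) x \<noteq> 0)"
  using mem_jac_open[OF assms] mem_proj_curve[OF assms] by (auto simp: jac_inter_def)

lemma tangent_scale:
  assumes "homogeneous e G" "c \<noteq> 0"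
  shows "tangent G (c *s x) = tangent G x"
  using assms(2)
  by (auto simp: tangent_def peval_scale[OF homogeneous_pdiff[OF assms(1)] assms(2)] mult.assoc
      simp flip: sum_distrib_left)

lemma tangent_smult: "v \<in> tangent G x \<Longrightarrow> c *s v \<in> tangent G x"
  by (simp add: tangent_def mult.left_commute[of _ c] flip: sum_distrib_left)

lemma alternating_1:
  assumes "alternating 1 a"
  shows "a [b *s v + c *s w] = b * a [v] + c * a [w]"
proof -
  show ?thesis
    using assms[unfolded alternating_def, THEN conjunct1, rule_format, of "[v]" 0 b v c w] by simp
qed

text \<open>The factor 1 gives both sums the shape b v + c w, so that \<open>alternating_1\<close>
  can be applied twice.\<close>

lemma vec3_decomp: "v = (v $ 0) *s axis 0 1 + 1 *s ((v $ 1) *s axis 1 1 + (v $ 2) *s axis 2 1)"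
  for v :: "complex ^ 3"
  using index3_cases index3_neq index3_neq[symmetric]
  by (auto simp: vec_eq_iff axis_def)

lemma alternating_1_coords:
  assumes "alternating 1 a"
  shows "a [v] = (\<Sum>i\<in>UNIV. v $ i * a [axis i 1])"
  by (subst vec3_decomp, subst alternating_1[OF assms], subst alternating_1[OF assms])
    (simp add: sum_index3)

text \<open>Let \<open>\<alpha>\<close> extend \<open>\<omega>\<close> near \<open>x\<close>. Differentiating \<open>\<alpha>\<^sub>y(u) = \<omega>\<^sub>y(u)\<close> along the ray through \<open>x\<close>, and
  \<open>\<alpha>\<^sub>y(y) = 0\<close> along a curve on the cone with velocity \<open>u\<close>, gives \<open>d\<alpha>(x, u) = 0\<close>.\<close>

lemma ambient_d_extension_eq_0:
  assumes hom: "homogeneous e G" and \<omega>: "\<omega> \<in> holo_forms G 1 (jac_inter G I)" and I: "i \<in> set I"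
    and ext: "local_extension G 1 (jac_inter G I) \<omega> x N \<alpha>"
    and fr: "(x, [v, w]) \<in> frames G 2 (jac_inter G I)"
  shows "ambient_d \<alpha> x [v, w] = 0"
proof -
  let ?V = "jac_inter G I"
  have x0: "x \<noteq> 0" and xV: "proj x \<in> ?V" and vw: "v \<in> tangent G x" "w \<in> tangent G x"
    using fr by (auto simp: frames_def)
  have Gx: "peval G x = 0" and Gi: "peval (pdiff i G) x \<noteq> 0"
    using xV I by (auto simp: mem_jac_inter[OF hom x0])
  have N: "open N" "x \<in> N" and alt: "\<And>y. y \<in> N \<Longrightarrow> alternating 1 (\<alpha> y)"
    and hol: "\<And>u. holomorphic3_on (\<lambda>y. \<alpha> y [u]) N"
    and eq: "\<And>y u. y \<in> N \<Longrightarrow> (y, [u]) \<in> frames G 1 ?V \<Longrightarrow> \<alpha> y [u] = \<omega> y [u]"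
    using ext by (auto simp: local_extension_def ambient_forms_def)
  have \<omega>_scale: "\<omega> (c *s y) [c *s u] = \<omega> y [u]" if "(y, [u]) \<in> frames G 1 ?V" "c \<noteq> 0" for y u c
    using \<omega> that unfolding holo_forms_def by fastforce
  have \<omega>_radial: "\<omega> y [y] = 0" if "(y, [y]) \<in> frames G 1 ?V" for y
    using \<omega> that unfolding holo_forms_def by fastforce
  define F where "F u = frechet_derivative (\<lambda>y. \<alpha> y [u]) (at x)" for u
  have F: "((\<lambda>y. \<alpha> y [u]) has_derivative F u) (at x)" for u
    using hol[of u] N(2) unfolding holomorphic3_on_def F_def
    by (meson differentiableI frechet_derivative_works)
  \<comment> \<open>\<open>has_derivative\<close> provides real linearity only; complex linearity
    comes from \<open>holomorphic3_on\<close> and uniqueness of derivatives.\<close>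
  have F_smult: "F u (c *s v) = c * F u v" for u c v
  proof -
    obtain L where L: "((\<lambda>y. \<alpha> y [u]) has_derivative L) (at x)" "\<And>c v. L (c *s v) = c * L v"
      using hol[of u] N(2) unfolding holomorphic3_on_def by blast
    show ?thesis
      using has_derivative_unique[OF F L(1)] L(2) by simp
  qed
  have F_add: "F u (v + v') = F u v + F u v'" for u v v'
    using has_derivative_bounded_linear[OF F] by (simp add: linear_simps)
  have F_arg: "F u v = (\<Sum>k\<in>UNIV. u $ k * F (axis k 1) v)" for u v
  proof -
    have "((\<lambda>y. \<Sum>k\<in>UNIV. u $ k * \<alpha> y [axis k 1]) has_derivative
        (\<lambda>v. \<Sum>k\<in>UNIV. u $ k * F (axis k 1) v)) (at x)"
      by (intro has_derivative_sum has_derivative_mult_right F)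
    then have "((\<lambda>y. \<alpha> y [u]) has_derivative (\<lambda>v. \<Sum>k\<in>UNIV. u $ k * F (axis k 1) v)) (at x)"
      by (rule has_derivative_transform_within_open[OF _ N])
        (simp add: alternating_1_coords[OF alt, of _ u])
    from has_derivative_unique[OF F this] show ?thesis
      by (rule fun_cong)
  qed
  have F_vec: "F u v = (\<Sum>k\<in>UNIV. v $ k * F u (axis k 1))" for u v
    by (subst vec3_decomp) (simp only: F_add F_smult sum_index3 mult_1 add.assoc)
  have xT: "x \<in> tangent G x"
    by (rule euler_tangent[OF hom Gx])
  \<comment> \<open>Writing u = c (u / c), scale invariance gives \<alpha>(u) at c x as 1 / c times
    \<alpha>(u) at x. With c = 1 + t, the derivative at t = 0 is the negative of the value at
    x.\<close>
  have ray: "F u x = - \<alpha> x [u]" if u: "u \<in> tangent G x" for u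
  proof -
    let ?l = "\<lambda>t::real. x + t *\<^sub>R x"
    have l: "?l t = of_real (1 + t) *s x" for t
      by (simp add: vec_eq_iff scaleR_conv_of_real[where 'a=complex] algebra_simps)
    have "(?l has_derivative (\<lambda>t. t *\<^sub>R x)) (at 0)"
      by (auto intro!: derivative_eq_intros)
    moreover have "((\<lambda>y. \<alpha> y [u]) has_derivative F u) (at (?l 0))"
      using F by simp
    ultimately have "((\<lambda>t. \<alpha> (?l t) [u]) has_derivative (\<lambda>t. F u (t *\<^sub>R x))) (at 0)"
      by (rule has_derivative_compose)
    then have d1: "((\<lambda>t. \<alpha> (?l t) [u]) has_vector_derivative F u x) (at 0)"
      using has_derivative_bounded_linear[OF F]
      by (simp add: has_vector_derivative_def linear_simps)
    have d0: "((\<lambda>t. inverse (of_real (1 + t)) * \<alpha> x [u]) has_vector_derivative - \<alpha> x [u]) (at 0)"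
      by (auto intro!: derivative_eq_intros simp: has_vector_derivative_def scaleR_conv_of_real[where 'a=complex])
    \<comment> \<open>The bound t > -1 keeps the scaling factor 1 + t nonzero.\<close>
    have op: "open (?l -` N \<inter> {-1<..})"
      by (rule open_Int[OF open_vimage[OF N(1)] open_greaterThan]) (rule continuous_intros)+
    have d2: "((\<lambda>t. \<alpha> (?l t) [u]) has_vector_derivative - \<alpha> x [u]) (at 0)"
    proof (rule has_vector_derivative_transform_within_open[OF d0 op])
      fix t assume t: "t \<in> ?l -` N \<inter> {-1<..}"
      let ?c = "complex_of_real (1 + t)"
      have c: "?c \<noteq> 0"
        unfolding of_real_eq_0_iff using t by auto
      have "inverse ?c *s u \<in> tangent G x"
        using u by (rule tangent_smult)
      then have fr: "(x, [inverse ?c *s u]) \<in> frames G 1 ?V" "(x, [u]) \<in> frames G 1 ?V"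
          "(?l t, [u]) \<in> frames G 1 ?V"
        using u x0 xV c tangent_scale[OF hom c, of x] proj_scale[OF c, of x]
        by (auto simp: frames_def l simp del: of_real_add)
      have "\<alpha> (?l t) [u] = \<omega> (?c *s x) [?c *s (inverse ?c *s u)]"
        using eq[OF _ fr(3)] t c by (simp add: l)
      also have "\<dots> = \<alpha> x [inverse ?c *s u]"
        using \<omega>_scale[OF fr(1) c] eq[OF N(2) fr(1)] by simp
      also have "\<dots> = inverse ?c * \<alpha> x [u]"
        using alternating_1[OF alt[OF N(2)], of "inverse ?c" u 0 0] by simp
      finally show "inverse ?c * \<alpha> x [u] = \<alpha> (?l t) [u]" ..
    qed (use N in simp)
    show ?thesis
      using vector_derivative_unique_at[OF d1 d2] .
  qed
  \<comment> \<open>The product rule for \<alpha>(y) at the moving point y = \<gamma>(t) yields two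
    terms: \<open>F x u\<close> from the base point and \<open>\<alpha> x [u]\<close> from the
    argument.\<close>
  have along: "F x u = - \<alpha> x [u]" if u: "u \<in> tangent G x" for u
  proof -
    obtain \<gamma> where \<gamma>: "\<gamma> 0 = x" "(\<gamma> has_vector_derivative u) (at 0)" "\<forall>\<^sub>F t in nhds 0. peval G (\<gamma> t) = 0"
      using zero_set_curve[OF Gx Gi u] by blast
    have cont: "(\<gamma> \<longlongrightarrow> x) (nhds 0)"
      using has_vector_derivative_continuous[OF \<gamma>(2)] \<gamma>(1)
      by (simp add: continuous_at tendsto_nhds_iff)
    \<comment> \<open>A zero of G in this open set lies over the intersection of the cover, where
      \<open>\<alpha>\<close> agrees with \<open>\<omega>\<close> on tangent vectors.\<close>
    let ?M = "N \<inter> (\<Inter>i\<in>set I. {y. peval (pdiff i G) y \<noteq> 0}) \<inter> - {0}"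
    have "open ?M"
      using N by (auto intro!: open_Int open_INT open_peval_neq_0)
    moreover have "x \<in> ?M"
      using N x0 xV by (auto simp: mem_jac_inter[OF hom x0])
    ultimately have "\<forall>\<^sub>F t in nhds 0. \<gamma> t \<in> ?M"
      by (rule topological_tendstoD[OF cont])
    \<comment> \<open>The coordinate expansion separates the moving base point from the moving
      argument, so that the product rule applies.\<close>
    with \<gamma>(3) have "\<forall>\<^sub>F t in nhds 0. (\<Sum>k\<in>UNIV. \<gamma> t $ k * \<alpha> (\<gamma> t) [axis k 1]) = 0"
    proof eventually_elim
      case (elim t)
      then have "(\<gamma> t, [\<gamma> t]) \<in> frames G 1 ?V"
        using euler_tangent[OF hom, of "\<gamma> t"] by (auto simp: frames_def mem_jac_inter[OF hom])
      then show ?case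
        using elim eq[of "\<gamma> t" "\<gamma> t"] \<omega>_radial[of "\<gamma> t"] alternating_1_coords[OF alt, of "\<gamma> t" "\<gamma> t"]
        by simp
    qed
    then obtain S where S: "open S" "0 \<in> S" "\<And>t. t \<in> S \<Longrightarrow> (\<Sum>k\<in>UNIV. \<gamma> t $ k * \<alpha> (\<gamma> t) [axis k 1]) = 0"
      unfolding eventually_nhds by blast
    have d1: "((\<lambda>t. \<Sum>k\<in>UNIV. \<gamma> t $ k * \<alpha> (\<gamma> t) [axis k 1]) has_derivative (\<lambda>t. 0)) (at 0)"
      by (rule has_derivative_transform_within_open[OF has_derivative_const S(1,2)]) (simp only: S(3))
    have d\<gamma>: "(\<gamma> has_derivative (\<lambda>t. t *\<^sub>R u)) (at 0)"
      using \<gamma>(2) by (simp add: has_vector_derivative_def)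
    have "((\<lambda>y. \<alpha> y [a]) has_derivative F a) (at (\<gamma> 0))" for a
      using F \<gamma>(1) by simp
    from has_derivative_compose[OF d\<gamma> this]
    have "((\<lambda>t. \<Sum>k\<in>UNIV. \<gamma> t $ k * \<alpha> (\<gamma> t) [axis k 1]) has_derivative
       (\<lambda>t. \<Sum>k\<in>UNIV. \<gamma> 0 $ k * F (axis k 1) (t *\<^sub>R u) + (t *\<^sub>R u) $ k * \<alpha> (\<gamma> 0) [axis k 1])) (at 0)"
      by (intro has_derivative_sum has_derivative_mult
          bounded_linear.has_derivative[OF bounded_linear_vec_nth] d\<gamma>)
    from fun_cong[OF has_derivative_unique[OF this d1], of 1]
    have "(\<Sum>k\<in>UNIV. x $ k * F (axis k 1) u + u $ k * \<alpha> x [axis k 1]) = 0"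
      by (simp add: \<gamma>(1))
    then show ?thesis
      by (simp add: sum.distrib flip: F_arg alternating_1_coords[OF alt[OF N(2)]])
        (simp add: eq_neg_iff_add_eq_0)
  qed
  \<comment> \<open>d\<alpha>(v, w) is \<open>F w v - F v w\<close>. The right-hand sides of
    \<open>ray\<close> and \<open>along\<close> coincide, so it vanishes on the pairs (x, u), hence
    on the tangent plane.\<close>
  have "F w v = F v w"
  proof (rule alternating_on_plane_eq_0[where T="tangent G x" and g="\<lambda>k. peval (pdiff k G) x" and i=i
          and a="\<lambda>k j. F (axis k 1) (axis j 1)"])
    show "F v w = (\<Sum>k\<in>UNIV. \<Sum>j\<in>UNIV. F (axis k 1) (axis j 1) * v $ k * w $ j)" for v w
      by (subst F_arg, subst F_vec) (simp add: sum_distrib_left mult_ac)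
  qed (use tangent_iff xT x0 Gi ray along vw in auto)
  then show ?thesis
    by (simp add: ambient_d_def omit_def lessThan_Suc F_def)
qed

text \<open>A curve carries no nonzero 2-forms. Formally, an extension exists and every extension
  gives 0, which determines the \<open>THE\<close>. A nonempty \<open>I\<close> supplies the
  nonvanishing partial derivative.\<close>

lemma curve_d_eq_0:
  assumes "homogeneous e G" "\<omega> \<in> holo_forms G 1 (jac_inter G I)" "I \<noteq> []"
  shows "curve_d G 1 (jac_inter G I) \<omega> x vs = 0"
proof (cases "(x, vs) \<in> frames G 2 (jac_inter G I)")
  case True
  then have x: "x \<noteq> 0" "proj x \<in> jac_inter G I" and "length vs = 2"
    by (auto simp: frames_def)
  then obtain v w where vs: "vs = [v, w]"
    by (auto simp: numeral_2_eq_2 length_Suc_conv)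
  obtain i where i: "i \<in> set I"
    using assms(3) by (cases I) auto
  obtain N \<alpha> where ext: "local_extension G 1 (jac_inter G I) \<omega> x N \<alpha>"
    using assms(2) x unfolding holo_forms_def by blast
  have "ambient_d \<beta> x vs = 0" if "local_extension G 1 (jac_inter G I) \<omega> x M \<beta>" for M \<beta>
    using ambient_d_extension_eq_0[OF assms(1,2) i that] True by (simp add: vs)
  then have "(THE c. \<exists>N \<alpha>. local_extension G 1 (jac_inter G I) \<omega> x N \<alpha> \<and> c = ambient_d \<alpha> x vs) = 0"
    using ext by (intro the_equality) metis+
  then show ?thesis
    by (simp add: curve_d_def)
qed (simp add: curve_d_def numeral_2_eq_2)

section \<open>Rational forms are holomorphic\<close>

lemma holomorphic3_on_peval: "holomorphic3_on (peval P) N"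
  unfolding holomorphic3_on_def
  by (intro ballI exI conjI allI, rule has_derivative_peval)
    (simp add: sum_distrib_left mult.left_commute)

lemma holomorphic3_on_mult:
  assumes "holomorphic3_on f N" "holomorphic3_on g N"
  shows "holomorphic3_on (\<lambda>y. f y * g y) N"
  unfolding holomorphic3_on_def
proof
  fix y assume "y \<in> N"
  then obtain F H where "(f has_derivative F) (at y)" "\<And>c v. F (c *s v) = c * F v"
      "(g has_derivative H) (at y)" "\<And>c v. H (c *s v) = c * H v"
    using assms unfolding holomorphic3_on_def by meson
  then show "\<exists>L. ((\<lambda>y. f y * g y) has_derivative L) (at y) \<and> (\<forall>c v. L (c *s v) = c * L v)"
    by (intro exI[of _ "\<lambda>v. f y * H v + F v * g y"]) (intro conjI has_derivative_mult, auto simp: algebra_simps)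
qed

lemma holomorphic3_on_divide:
  assumes "holomorphic3_on f N" "holomorphic3_on g N" "\<And>y. y \<in> N \<Longrightarrow> g y \<noteq> 0"
  shows "holomorphic3_on (\<lambda>y. f y / g y) N"
  unfolding holomorphic3_on_def
proof
  fix y assume y: "y \<in> N"
  then obtain F H where "(f has_derivative F) (at y)" "\<And>c v. F (c *s v) = c * F v"
      "(g has_derivative H) (at y)" "\<And>c v. H (c *s v) = c * H v"
    using assms(1,2) unfolding holomorphic3_on_def by meson
  then show "\<exists>L. ((\<lambda>y. f y / g y) has_derivative L) (at y) \<and> (\<forall>c v. L (c *s v) = c * L v)"
    using assms(3)[OF y]
    by (intro exI[of _ "\<lambda>v. (F v * g y - f y * H v) / (g y * g y)"])
      (intro conjI has_derivative_divide', auto simp: algebra_simps diff_divide_distrib)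
qed

lemma Omega1_linear: "Omega1 j x [b *s v + c *s w] = b * Omega1 j x [v] + c * Omega1 j x [w]"
  using index3_cases[of j] by (auto simp: Omega1_explicit algebra_simps)

lemma Omega1_scale: "Omega1 j (c *s x) [c *s v] = c\<^sup>2 * Omega1 j x [v]"
  using index3_cases[of j] by (auto simp: Omega1_explicit algebra_simps power2_eq_square)

lemma Omega1_radial: "Omega1 j x [x] = 0"
  using index3_cases[of j] by (auto simp: Omega1_explicit)

text \<open>For a fixed vector the value is a linear polynomial in the base point.\<close>

lemma holomorphic3_on_Omega1: "holomorphic3_on (\<lambda>y. Omega1 j y [v]) N"
proof -
  have "\<exists>P. \<forall>y. Omega1 j y [v] = peval P y"
  proof -
    have *: "peval (Poly_Mapping.single 0 c * P) y = c * peval P y" for c P y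
      by (simp add: peval_mult peval_single monom_val_def)
    have "\<exists>P. \<forall>y. y $ k * a - y $ l * b = peval P y" for k l a b
      by (rule exI[of _ "Poly_Mapping.single 0 a * coord k - Poly_Mapping.single 0 b * coord l"])
        (simp add: peval_diff * peval_coord)
    then show ?thesis
      using index3_cases[of j] by (auto simp: Omega1_explicit)
  qed
  then obtain P where "(\<lambda>y. Omega1 j y [v]) = peval P"
    by blast
  then show ?thesis
    by (simp add: holomorphic3_on_peval)
qed

text \<open>Intended for the ordered pairs (01), (02), (12) only, which the two tests tell apart. As
  a polynomial, \<Omega>_ij has a degree and is covered by the lemmas on
  \<open>peval\<close>.\<close>

definition Omega2_poly :: "3 \<Rightarrow> 3 \<Rightarrow> poly3" where
  "Omega2_poly i j = (if i = 1 then coord 0 else if j = 1 then coord 2 else - coord 1)"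

lemma Omega2_eq_peval:
  assumes "[i, j] \<in> simplices 1"
  shows "Omega2 i j x [] = peval (Omega2_poly i j) x"
  using assms index3_neq index3_neq[symmetric] unfolding simplices_1
  by (auto simp: Omega2_explicit Omega2_poly_def peval_coord peval_uminus)

lemma homogeneous_Omega2_poly: "homogeneous 1 (Omega2_poly i j)"
  by (simp add: Omega2_poly_def homogeneous_coord homogeneous_uminus)

lemma frames_scale:
  assumes "homogeneous e G" "c \<noteq> 0" "(x, vs) \<in> frames G p V"
  shows "(c *s x, map ((*s) c) vs) \<in> frames G p V"
  using assms(2,3) by (auto simp: frames_def proj_scale tangent_scale[OF assms(1)] tangent_smult)

text \<open>A single ambient form on one open set N serves as local extension at every point over
  V.\<close>

lemma restrict_form_in_holo_forms:
  assumes "homogeneous e G" "open N" "\<alpha> \<in> ambient_forms p N"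
    and "\<And>x. x \<noteq> 0 \<Longrightarrow> proj x \<in> V \<Longrightarrow> x \<in> N"
    and "\<And>c x vs. c \<noteq> 0 \<Longrightarrow> (x, vs) \<in> frames G p V \<Longrightarrow> \<alpha> (c *s x) (map ((*s) c) vs) = \<alpha> x vs"
    and "\<And>x vs. (x, vs) \<in> frames G p V \<Longrightarrow> x \<in> set vs \<Longrightarrow> \<alpha> x vs = 0"
  shows "restrict_form G p V \<alpha> \<in> holo_forms G p V"
  unfolding holo_forms_def mem_Collect_eq
proof (intro conjI allI impI)
  fix x assume "x \<noteq> 0" "proj x \<in> V"
  then have "local_extension G p V (restrict_form G p V \<alpha>) x N \<alpha>"
    using assms by (simp add: local_extension_def restrict_form_def)
  then show "\<exists>N \<beta>. local_extension G p V (restrict_form G p V \<alpha>) x N \<beta>"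
    by blast
qed (use assms(5,6) frames_scale[OF assms(1)] in \<open>auto simp: restrict_form_def\<close>)

text \<open>Under scaling by c, \<open>Omega1\<close> contributes c^2 and P / Q contributes c^(-2),
  whence the degree d + 2. With the vanishing on the radial vector the form descends to the
  projective plane.\<close>

lemma rat_form_Omega1_in_holo_forms:
  assumes G: "homogeneous e G" and P: "homogeneous d P" and Q: "homogeneous (d + 2) Q"
    and Q0: "\<And>x. x \<noteq> 0 \<Longrightarrow> proj x \<in> V \<Longrightarrow> peval Q x \<noteq> 0"
  shows "restrict_form G 1 V (rat_form P Q (Omega1 j)) \<in> holo_forms G 1 V"
proof (rule restrict_form_in_holo_forms[OF G open_peval_neq_0[of Q]])
  have alt: "alternating 1 (rat_form P Q (Omega1 j) y)" for y
    by (auto simp: alternating_def rat_form_def Omega1_linear length_Suc_conv algebra_simps add_divide_distrib)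
  have "holomorphic3_on (\<lambda>y. rat_form P Q (Omega1 j) y [v]) {y. peval Q y \<noteq> 0}" for v
    unfolding rat_form_def
    by (intro holomorphic3_on_mult holomorphic3_on_divide holomorphic3_on_peval holomorphic3_on_Omega1) auto
  with alt show "rat_form P Q (Omega1 j) \<in> ambient_forms 1 {y. peval Q y \<noteq> 0}"
    by (auto simp: ambient_forms_def length_Suc_conv)
next
  fix c :: complex and x vs assume c: "c \<noteq> 0" and "(x, vs) \<in> frames G 1 V"
  then obtain v where "vs = [v]"
    by (auto simp: frames_def length_Suc_conv)
  with c show "rat_form P Q (Omega1 j) (c *s x) (map ((*s) c) vs) = rat_form P Q (Omega1 j) x vs"
    by (simp add: rat_form_def peval_scale[OF P c] peval_scale[OF Q c] Omega1_scale power_int_add)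
next
  fix x vs assume "(x, vs) \<in> frames G 1 V" "x \<in> set vs"
  then have "vs = [x]"
    by (auto simp: frames_def length_Suc_conv)
  then show "rat_form P Q (Omega1 j) x vs = 0"
    by (simp add: rat_form_def Omega1_radial)
qed (use Q0 in auto)

text \<open>\<open>Omega2\<close> has degree 1 in x, so the denominator exceeds the numerator by one
  degree.\<close>

lemma rat_form_Omega2_in_holo_forms:
  assumes G: "homogeneous e G" and P: "homogeneous d P" and Q: "homogeneous (d + 1) Q"
    and Q0: "\<And>x. x \<noteq> 0 \<Longrightarrow> proj x \<in> V \<Longrightarrow> peval Q x \<noteq> 0"
    and ij: "[i, j] \<in> simplices 1"
  shows "restrict_form G 0 V (rat_form P Q (Omega2 i j)) \<in> holo_forms G 0 V"
proof (rule restrict_form_in_holo_forms[OF G open_peval_neq_0[of Q]])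
  have "holomorphic3_on (\<lambda>y. rat_form P Q (Omega2 i j) y []) {y. peval Q y \<noteq> 0}"
    unfolding rat_form_def Omega2_eq_peval[OF ij]
    by (intro holomorphic3_on_mult holomorphic3_on_divide holomorphic3_on_peval) auto
  then show "rat_form P Q (Omega2 i j) \<in> ambient_forms 0 {y. peval Q y \<noteq> 0}"
    by (auto simp: ambient_forms_def alternating_def)
next
  fix c :: complex and x vs assume c: "c \<noteq> 0" and "(x, vs) \<in> frames G 0 V"
  with c show "rat_form P Q (Omega2 i j) (c *s x) (map ((*s) c) vs) = rat_form P Q (Omega2 i j) x vs"
    by (simp add: frames_def rat_form_def peval_scale[OF P c] peval_scale[OF Q c]
        Omega2_eq_peval[OF ij] peval_scale[OF homogeneous_Omega2_poly c] power_int_add)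
qed (use Q0 in \<open>auto simp: frames_def\<close>)

section \<open>The cochains and their products\<close>

definition cross_coeff :: "(3 \<Rightarrow> poly3) \<Rightarrow> 3 \<Rightarrow> poly3" where
  "cross_coeff R i = (if i = 0 then coord 1 * R 2 - coord 2 * R 1
     else if i = 1 then - coord 0 * R 2 + coord 2 * R 0
     else coord 0 * R 1 - coord 1 * R 0)"

text \<open>One family for both cochains of the theorem, with the sign of \<open>W12\<close> carried
  by R.\<close>

definition cross_cochain :: "poly3 \<Rightarrow> (3 \<Rightarrow> poly3) \<Rightarrow> cochain" where
  "cross_cochain G R = cochain0 G 1
     (rat_form (cross_coeff R 0) ((pdiff 0 G)\<^sup>2) (Omega1 0))
     (rat_form (cross_coeff R 1) ((pdiff 1 G)\<^sup>2) (Omega1 1))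
     (rat_form (cross_coeff R 2) ((pdiff 2 G)\<^sup>2) (Omega1 2))"

lemma simplices_0: "simplices 0 = {[0], [1], [2]}"
  using index3_cases by (fastforce simp: simplices_def length_Suc_conv)

lemma cross_cochain_singleton:
  "cross_cochain G R [i] = restrict_form G 1 (jac_inter G [i]) (rat_form (cross_coeff R i) ((pdiff i G)\<^sup>2) (Omega1 i))"
  using index3_cases[of i] index3_neq index3_neq[symmetric]
  by (auto simp: cross_cochain_def cochain0_def)

lemma attached10_singleton:
  "attached10 G U [i] = restrict_form G 1 (jac_inter G [i]) (rat_form U (pdiff i G) (Omega1 i))"
  using index3_cases[of i] index3_neq index3_neq[symmetric]
  by (auto simp: attached10_def cochain0_def)

lemma attached01_pair:
  assumes "[i, j] \<in> simplices 1"
  shows "attached01 G U [i, j] =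
    restrict_form G 0 (jac_inter G [i, j]) (rat_form U (pdiff i G * pdiff j G) (Omega2 i j))"
  using assms index3_neq index3_neq[symmetric] unfolding simplices_1
  by (auto simp: attached01_def cochain1_def)

lemma simplices_0_cases: "I \<in> simplices 0 \<Longrightarrow> \<exists>i. I = [i]"
  by (auto simp: simplices_0)

lemma simplices_1_cases: "I \<in> simplices 1 \<Longrightarrow> \<exists>i j. I = [i, j] \<and> i < j"
  by (fastforce simp: simplices_def length_Suc_conv)

lemma cochain0_not_simplex: "I \<notin> simplices 0 \<Longrightarrow> cochain0 G p a b c I = (\<lambda>x vs. 0)"
  by (auto simp: simplices_0 cochain0_def)

lemma cochain1_not_simplex: "I \<notin> simplices 1 \<Longrightarrow> cochain1 G p a b c I = (\<lambda>x vs. 0)"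
  unfolding simplices_1 by (auto simp: cochain1_def)

lemma homogeneous_cross_coeff:
  assumes "\<And>i. homogeneous d (R i)"
  shows "homogeneous (d + 1) (cross_coeff R i)"
  unfolding cross_coeff_def add.commute[of d]
  by (auto intro!: homogeneous_diff homogeneous_add homogeneous_mult homogeneous_uminus homogeneous_coord assms)

section \<open>Membership in the Cech-de Rham complex\<close>

lemma attached01_in_CdR:
  assumes G: "homogeneous n G" and U: "homogeneous (2 * n - 3) U"
  shows "attached01 G U \<in> CdR G 0 1"
proof -
  have "attached01 G U I \<in> holo_forms G 0 (jac_inter G I)" if I: "I \<in> simplices 1" for I
  proof -
    obtain i j where ij: "I = [i, j]"
      using simplices_1_cases[OF I] by blast
    have "homogeneous ((2 * n - 3) + 1) (pdiff i G * pdiff j G)"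
      using homogeneous_mult[OF homogeneous_pdiff[OF G] homogeneous_pdiff[OF G], of i j]
      by (simp add: algebra_simps)
    then show ?thesis
      unfolding ij attached01_pair[OF I[unfolded ij]]
      by (rule rat_form_Omega2_in_holo_forms[OF G U])
        (use I ij in \<open>auto simp: mem_jac_inter[OF G] peval_mult\<close>)
  qed
  then show ?thesis
    by (simp add: CdR_def attached01_def cochain1_not_simplex)
qed

lemma attached10_in_CdR:
  assumes G: "homogeneous n G" and U: "homogeneous (n - 3) U"
  shows "attached10 G U \<in> CdR G 1 0"
proof -
  have "attached10 G U [i] \<in> holo_forms G 1 (jac_inter G [i])" for i
    unfolding attached10_singleton
    by (rule rat_form_Omega1_in_holo_forms[OF G U])
      (use homogeneous_pdiff[OF G] in \<open>auto simp: mem_jac_inter[OF G]\<close>)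
  then show ?thesis
    using simplices_0_cases by (auto simp: CdR_def attached10_def cochain0_not_simplex)
qed

lemma cross_cochain_in_CdR:
  assumes G: "homogeneous n G" and R: "\<And>i. homogeneous (2 * n - 5) (R i)"
  shows "cross_cochain G R \<in> CdR G 1 0"
proof -
  have "cross_cochain G R [i] \<in> holo_forms G 1 (jac_inter G [i])" for i
    unfolding cross_cochain_singleton
  proof (rule rat_form_Omega1_in_holo_forms[OF G homogeneous_cross_coeff[OF R]])
    \<comment> \<open>The factor x in x \<times> R raises the degree by 1, and 2n - 4 + 2 = 2(n -
      1).\<close>
    show "homogeneous (2 * n - 5 + 1 + 2) ((pdiff i G)\<^sup>2)"
      using homogeneous_mult[OF homogeneous_pdiff[OF G] homogeneous_pdiff[OF G], of i i]
      by (simp add: algebra_simps power2_eq_square)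
  qed (auto simp: mem_jac_inter[OF G] peval_mult power2_eq_square)
  then show ?thesis
    using simplices_0_cases by (auto simp: CdR_def cross_cochain_def cochain0_not_simplex)
qed

section \<open>Values on tangent vectors and the Cech differential\<close>

lemma frames_1_face:
  assumes "(x, vs) \<in> frames G p (jac_inter G I)" "set J \<subseteq> set I"
  shows "(x, vs) \<in> frames G p (jac_inter G J)"
  using assms by (auto simp: frames_def jac_inter_def)

lemma attached01_frame:
  assumes "[i, j] \<in> simplices 1" "(x, [v]) \<in> frames G 1 (jac_inter G [i, j])"
  shows "attached01 G U [i, j] x [] =
    peval U x / (peval (pdiff i G) x * peval (pdiff j G) x) * peval (Omega2_poly i j) x"
  using assms(2)
  by (simp add: attached01_pair[OF assms(1)] restrict_form_def rat_form_def frames_def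
      Omega2_eq_peval[OF assms(1)] peval_mult)

lemma attached10_frame:
  assumes "(x, [v]) \<in> frames G 1 (jac_inter G I)" "i \<in> set I"
  shows "attached10 G U [i] x [v] = peval U x / peval (pdiff i G) x * Omega1 i x [v]"
  using frames_1_face[OF assms(1), of "[i]"] assms(2)
  by (simp add: attached10_singleton restrict_form_def rat_form_def)

lemma cross_cochain_frame:
  assumes "(x, [v]) \<in> frames G 1 (jac_inter G I)" "i \<in> set I"
  shows "cross_cochain G R [i] x [v] = peval (cross_coeff R i) x / (peval (pdiff i G) x)\<^sup>2 * Omega1 i x [v]"
  using frames_1_face[OF assms(1), of "[i]"] assms(2)
  by (simp add: cross_cochain_singleton restrict_form_def rat_form_def peval_mult power2_eq_square)

text \<open>Both \<open>x\<close> and \<open>v\<close> are orthogonal to the gradient, and \<open>\<Omega>\<^sub>i(v)\<close> is minus the \<open>i\<close>-th component of \<open>x \<times> v\<close>.\<close>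

lemma Omega1_proportional:
  assumes "x \<in> tangent G x" "v \<in> tangent G x"
  shows "peval (pdiff i G) x * Omega1 j x [v] = peval (pdiff j G) x * Omega1 i x [v]"
proof -
  have "peval (pdiff 0 G) x * Omega1 1 x [v] = peval (pdiff 1 G) x * Omega1 0 x [v]"
    "peval (pdiff 0 G) x * Omega1 2 x [v] = peval (pdiff 2 G) x * Omega1 0 x [v]"
    "peval (pdiff 1 G) x * Omega1 2 x [v] = peval (pdiff 2 G) x * Omega1 1 x [v]"
    using assms unfolding Omega1_explicit tangent_iff by algebra+
  then show ?thesis
    using index3_cases[of i] index3_cases[of j] by auto
qed

text \<open>\<open>cross_coeff R\<close> is \<open>x \<times> R\<close>, and \<open>\<Omega>\<^sub>i\<^sub>j\<close> are the components of \<open>x\<close>: this is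
  \<open>(x \<times> R) \<times> \<nabla>G = (x \<cdot> \<nabla>G) R - (R \<cdot> \<nabla>G) x\<close> with \<open>x \<cdot> \<nabla>G = 0\<close>.\<close>

lemma cross_coeff_antisym:
  assumes ij: "[i, j] \<in> simplices 1" and x: "x \<in> tangent G x"
  shows "peval (cross_coeff R j) x * peval (pdiff i G) x - peval (cross_coeff R i) x * peval (pdiff j G) x
    = peval (\<Sum>k\<in>UNIV. R k * pdiff k G) x * peval (Omega2_poly i j) x"
proof -
  note neq = index3_neq index3_neq[symmetric]
  have "peval (cross_coeff R 1) x * peval (pdiff 0 G) x - peval (cross_coeff R 0) x * peval (pdiff 1 G) x
      = peval (\<Sum>k\<in>UNIV. R k * pdiff k G) x * x $ 2"
    "peval (cross_coeff R 2) x * peval (pdiff 0 G) x - peval (cross_coeff R 0) x * peval (pdiff 2 G) x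
      = - peval (\<Sum>k\<in>UNIV. R k * pdiff k G) x * x $ 1"
    "peval (cross_coeff R 2) x * peval (pdiff 1 G) x - peval (cross_coeff R 1) x * peval (pdiff 2 G) x
      = peval (\<Sum>k\<in>UNIV. R k * pdiff k G) x * x $ 0"
    using x neq unfolding tangent_iff cross_coeff_def
    by (simp_all add: peval_add peval_uminus peval_diff peval_mult peval_coord sum_index3) algebra+
  then show ?thesis
    using ij neq unfolding simplices_1
    by (auto simp: Omega2_poly_def peval_coord peval_uminus)
qed

text \<open>Each component is (A_i / G_i) (\<Omega>_i / G_i), and by the second claim the last
  factor is common to i and j. The difference of the A_i / G_i over a common denominator is
  \<open>cross_coeff_antisym\<close>. The second claim also moves a 1-form from the front vertex to
  the back vertex.\<close>

lemma cross_cochain_diff: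
  fixes R :: "3 \<Rightarrow> poly3"
  assumes G: "homogeneous n G" and ij: "[i, j] \<in> simplices 1"
    and fr: "(x, [v]) \<in> frames G 1 (jac_inter G [i, j])"
  defines "w \<equiv> peval (\<Sum>k\<in>UNIV. R k * pdiff k G) x
      / (peval (pdiff i G) x * peval (pdiff j G) x) * peval (Omega2_poly i j) x"
  shows "cross_cochain G R [j] x [v] - cross_cochain G R [i] x [v] = w * (Omega1 j x [v] / peval (pdiff j G) x)"
    and "Omega1 i x [v] / peval (pdiff i G) x = Omega1 j x [v] / peval (pdiff j G) x"
proof -
  have x0: "x \<noteq> 0" and v: "v \<in> tangent G x" and xV: "proj x \<in> jac_inter G [i, j]"
    using fr by (auto simp: frames_def)
  have nz: "peval (pdiff i G) x \<noteq> 0" "peval (pdiff j G) x \<noteq> 0" and xT: "x \<in> tangent G x"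
    using xV euler_tangent[OF G] by (auto simp: mem_jac_inter[OF G x0])
  show eq: "Omega1 i x [v] / peval (pdiff i G) x = Omega1 j x [v] / peval (pdiff j G) x"
    using Omega1_proportional[OF xT v, of i j] nz by (simp add: field_simps)
  have "cross_cochain G R [j] x [v] - cross_cochain G R [i] x [v]
      = peval (cross_coeff R j) x / peval (pdiff j G) x * (Omega1 j x [v] / peval (pdiff j G) x)
      - peval (cross_coeff R i) x / peval (pdiff i G) x * (Omega1 i x [v] / peval (pdiff i G) x)"
    using cross_cochain_frame[OF fr, of _ R] by (simp add: power2_eq_square)
  also have "\<dots> = (peval (cross_coeff R j) x * peval (pdiff i G) x - peval (cross_coeff R i) x * peval (pdiff j G) x)
      / (peval (pdiff i G) x * peval (pdiff j G) x) * (Omega1 j x [v] / peval (pdiff j G) x)"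
    unfolding eq using nz by (simp add: divide_simps) (simp add: algebra_simps)
  finally show "cross_cochain G R [j] x [v] - cross_cochain G R [i] x [v] = w * (Omega1 j x [v] / peval (pdiff j G) x)"
    by (simp add: cross_coeff_antisym[OF ij xT] w_def)
qed

text \<open>The d part vanishes by \<open>curve_d_eq_0\<close>, and the sign (-1)^p with p = 1 turns
  the Cech difference into component i minus component j. Off the frames both sides are 0.\<close>

lemma total_D_cross_cochain:
  assumes G: "homogeneous n G" and R: "\<And>i. homogeneous (2 * n - 5) (R i)"
    and B: "\<And>I x vs. I \<notin> simplices 1 \<or> (x, vs) \<notin> frames G 1 (jac_inter G I) \<Longrightarrow> B I x vs = 0"
    and eq: "\<And>i j x v. [i, j] \<in> simplices 1 \<Longrightarrow> (x, [v]) \<in> frames G 1 (jac_inter G [i, j]) \<Longrightarrow>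
      B [i, j] x [v] = cross_cochain G R [i] x [v] - cross_cochain G R [j] x [v]"
  shows "total_D G 1 0 (cross_cochain G R) = B"
proof (intro ext)
  fix I x vs
  have "cross_cochain G R \<in> CdR G 1 0"
    by (rule cross_cochain_in_CdR[OF G R])
  then have d: "cech_d G 1 0 (cross_cochain G R) I x vs = 0"
    using curve_d_eq_0[OF G] simplices_0_cases unfolding cech_d_def CdR_def by fastforce
  show "total_D G 1 0 (cross_cochain G R) I x vs = B I x vs"
  proof (cases "I \<in> simplices 1 \<and> (x, vs) \<in> frames G 1 (jac_inter G I)")
    case True
    then obtain i j v where ij: "I = [i, j]" "i < j" "vs = [v]"
      using simplices_1_cases[of I] by (auto simp: frames_def length_Suc_conv)
    then show ?thesis
      using True d eq cech_delta_0[of i j x "[v]" G 1] by (simp add: total_D_def)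
  next
    case False
    then show ?thesis
      using d B[of I x vs] by (auto simp: total_D_def cech_delta_def restrict_form_def)
  qed
qed

section \<open>The bullet products: the two identities and holomorphy\<close>

lemma cech_bullet_support:
  assumes "I \<notin> simplices (q + s) \<or> (x, vs) \<notin> frames G (p + r) (jac_inter G I)"
  shows "cech_bullet G p q r s \<phi> \<psi> I x vs = 0"
  using assms by (auto simp: cech_bullet_def cech_wedge_def restrict_form_def)

text \<open>Here q = r = 1, so the product carries the sign -1, matching the sign of \<delta> in D;
  the relation for U U' therefore has none.\<close>

lemma total_D_cross_cochain_01_10:
  assumes G: "homogeneous n G" and R: "\<And>i. homogeneous (2 * n - 5) (R i)"
    and U: "U * U' = (\<Sum>k\<in>UNIV. R k * pdiff k G)"
  shows "total_D G 1 0 (cross_cochain G R) = cech_bullet G 0 1 1 0 (attached01 G U) (attached10 G U')"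
proof (rule total_D_cross_cochain[OF G R])
  fix i j x v assume ij: "[i, j] \<in> simplices 1" and fr: "(x, [v]) \<in> frames G 1 (jac_inter G [i, j])"
  then have "i < j"
    by (simp add: simplices_def)
  then have "cech_bullet G 0 1 1 0 (attached01 G U) (attached10 G U') [i, j] x [v]
      = - (attached01 G U [i, j] x [] * attached10 G U' [j] x [v])"
    using fr by (rule cech_bullet_01_10)
  also have "\<dots> = - (cross_cochain G R [j] x [v] - cross_cochain G R [i] x [v])"
    unfolding cross_cochain_diff(1)[OF G ij fr]
    by (simp add: attached01_frame[OF ij fr] attached10_frame[OF fr] peval_mult mult_ac flip: U)
  also have "\<dots> = cross_cochain G R [i] x [v] - cross_cochain G R [j] x [v]"
    by simp
  finally show "cech_bullet G 0 1 1 0 (attached01 G U) (attached10 G U') [i, j] x [v]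
      = cross_cochain G R [i] x [v] - cross_cochain G R [j] x [v]" .
qed (auto intro: cech_bullet_support)

text \<open>Here q = 0 and the product carries no sign, so the sign of \<delta> in D appears in the
  hypothesis on U' U. The 1-form sits at the front vertex i and is moved to j.\<close>

lemma total_D_cross_cochain_10_01:
  assumes G: "homogeneous n G" and R: "\<And>i. homogeneous (2 * n - 5) (R i)"
    and U: "U' * U = - (\<Sum>k\<in>UNIV. R k * pdiff k G)"
  shows "total_D G 1 0 (cross_cochain G R) = cech_bullet G 1 0 0 1 (attached10 G U') (attached01 G U)"
proof (rule total_D_cross_cochain[OF G R])
  fix i j x v assume ij: "[i, j] \<in> simplices 1" and fr: "(x, [v]) \<in> frames G 1 (jac_inter G [i, j])"
  then have "i < j"
    by (simp add: simplices_def)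
  then have "cech_bullet G 1 0 0 1 (attached10 G U') (attached01 G U) [i, j] x [v]
      = attached10 G U' [i] x [v] * attached01 G U [i, j] x []"
    using fr by (rule cech_bullet_10_01)
  also have "\<dots> = peval U' x * (Omega1 i x [v] / peval (pdiff i G) x) * attached01 G U [i, j] x []"
    by (simp add: attached10_frame[OF fr])
  also have "\<dots> = - (cross_cochain G R [j] x [v] - cross_cochain G R [i] x [v])"
  proof -
    have "peval (\<Sum>k\<in>UNIV. R k * pdiff k G) x = - (peval U' x * peval U x)"
      using arg_cong[OF U, of "\<lambda>P. peval P x"] by (simp add: peval_mult peval_uminus)
    then show ?thesis
      unfolding cross_cochain_diff[OF G ij fr]
      by (simp add: attached01_frame[OF ij fr] mult_ac)
  qed
  also have "\<dots> = cross_cochain G R [i] x [v] - cross_cochain G R [j] x [v]"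
    by simp
  finally show "cech_bullet G 1 0 0 1 (attached10 G U') (attached01 G U) [i, j] x [v]
      = cross_cochain G R [i] x [v] - cross_cochain G R [j] x [v]" .
qed (auto intro: cech_bullet_support)

text \<open>A function times a multiple of \<Omega>_k is again a rational multiple of \<Omega>_k.
  The vertex k may depend on the pair, since the two products place their 1-form at different
  ends.\<close>

lemma cochain_in_CdR_1_1:
  assumes G: "homogeneous n G"
    and P: "\<And>i j. homogeneous d (P i j)" and Q: "\<And>i j. homogeneous (d + 2) (Q i j)"
    and Q0: "\<And>i j x. x \<noteq> 0 \<Longrightarrow> proj x \<in> jac_inter G [i, j] \<Longrightarrow> peval (Q i j) x \<noteq> 0"
    and B: "\<And>I x vs. I \<notin> simplices 1 \<or> (x, vs) \<notin> frames G 1 (jac_inter G I) \<Longrightarrow> B I x vs = 0"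
    and eq: "\<And>i j x v. [i, j] \<in> simplices 1 \<Longrightarrow> (x, [v]) \<in> frames G 1 (jac_inter G [i, j]) \<Longrightarrow>
      B [i, j] x [v] = peval (P i j) x / peval (Q i j) x * Omega1 (k i j) x [v]"
  shows "B \<in> CdR G 1 1"
proof -
  have "B I \<in> holo_forms G 1 (jac_inter G I)" if I: "I \<in> simplices 1" for I
  proof -
    obtain i j where ij: "I = [i, j]"
      using simplices_1_cases[OF I] by blast
    have "B I = restrict_form G 1 (jac_inter G I) (rat_form (P i j) (Q i j) (Omega1 (k i j)))"
    proof (intro ext)
      fix x vs
      show "B I x vs = restrict_form G 1 (jac_inter G I) (rat_form (P i j) (Q i j) (Omega1 (k i j))) x vs"
      proof (cases "(x, vs) \<in> frames G 1 (jac_inter G I)")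
        case True
        then obtain v where "vs = [v]"
          by (auto simp: frames_def length_Suc_conv)
        then show ?thesis
          using eq True I by (simp add: ij restrict_form_def rat_form_def)
      qed (simp add: B restrict_form_def)
    qed
    then show ?thesis
      using rat_form_Omega1_in_holo_forms[OF G P Q Q0] by (simp add: ij)
  qed
  then show ?thesis
    using B unfolding CdR_def by (intro CollectI conjI ballI allI impI ext) blast+
qed

lemma cech_bullet_01_10_in_CdR:
  assumes G: "homogeneous n G" and U: "homogeneous (2 * n - 3) U" and U': "homogeneous (n - 3) U'"
  shows "cech_bullet G 0 1 1 0 (attached01 G U) (attached10 G U') \<in> CdR G 1 1"
\<comment> \<open>The minus sign is (-1)^(qr). The 1-form factor belongs to the back vertex j, so
  G_j occurs twice in the denominator.\<close>
proof (rule cochain_in_CdR_1_1[OF G, where P="\<lambda>i j. - (U * U' * Omega2_poly i j)"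
      and Q="\<lambda>i j. pdiff i G * pdiff j G * pdiff j G" and k="\<lambda>i j. j"])
  show "homogeneous (2 * n - 3 + (n - 3) + 1) (- (U * U' * Omega2_poly i j))" for i j
    by (intro homogeneous_uminus homogeneous_mult U U' homogeneous_Omega2_poly)
  show "homogeneous (2 * n - 3 + (n - 3) + 1 + 2) (pdiff i G * pdiff j G * pdiff j G)" for i j
    using homogeneous_mult[OF homogeneous_mult[OF homogeneous_pdiff[OF G] homogeneous_pdiff[OF G]]
        homogeneous_pdiff[OF G], of i j j] by (simp add: algebra_simps)
next
  fix i j x v assume ij: "[i, j] \<in> simplices 1" and fr: "(x, [v]) \<in> frames G 1 (jac_inter G [i, j])"
  have "i < j"
    using ij by (simp add: simplices_def)
  show "cech_bullet G 0 1 1 0 (attached01 G U) (attached10 G U') [i, j] x [v]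
      = peval (- (U * U' * Omega2_poly i j)) x / peval (pdiff i G * pdiff j G * pdiff j G) x * Omega1 j x [v]"
    unfolding cech_bullet_01_10[OF \<open>i < j\<close> fr] attached01_frame[OF ij fr] peval_mult peval_uminus
    by (simp add: attached10_frame[OF fr] mult_ac)
qed (auto intro: cech_bullet_support simp: mem_jac_inter[OF G] peval_mult)

lemma cech_bullet_10_01_in_CdR:
  assumes G: "homogeneous n G" and U: "homogeneous (2 * n - 3) U" and U': "homogeneous (n - 3) U'"
  shows "cech_bullet G 1 0 0 1 (attached10 G U') (attached01 G U) \<in> CdR G 1 1"
proof (rule cochain_in_CdR_1_1[OF G, where P="\<lambda>i j. U' * U * Omega2_poly i j"
      and Q="\<lambda>i j. pdiff i G * (pdiff i G * pdiff j G)" and k="\<lambda>i j. i"])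
  show "homogeneous (n - 3 + (2 * n - 3) + 1) (U' * U * Omega2_poly i j)" for i j
    by (intro homogeneous_mult U U' homogeneous_Omega2_poly)
  show "homogeneous (n - 3 + (2 * n - 3) + 1 + 2) (pdiff i G * (pdiff i G * pdiff j G))" for i j
    using homogeneous_mult[OF homogeneous_pdiff[OF G]
        homogeneous_mult[OF homogeneous_pdiff[OF G] homogeneous_pdiff[OF G]], of i i j] by (simp add: algebra_simps)
next
  fix i j x v assume ij: "[i, j] \<in> simplices 1" and fr: "(x, [v]) \<in> frames G 1 (jac_inter G [i, j])"
  have "i < j"
    using ij by (simp add: simplices_def)
  show "cech_bullet G 1 0 0 1 (attached10 G U') (attached01 G U) [i, j] x [v]
      = peval (U' * U * Omega2_poly i j) x / peval (pdiff i G * (pdiff i G * pdiff j G)) x * Omega1 i x [v]"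
    unfolding cech_bullet_10_01[OF \<open>i < j\<close> fr] attached01_frame[OF ij fr] peval_mult
    by (simp add: attached10_frame[OF fr] mult_ac)
qed (auto intro: cech_bullet_support simp: mem_jac_inter[OF G] peval_mult)

theorem proposition2p2:
  fixes n :: nat and G U0 U1 U2 :: poly3 and R01 R12 :: "3 \<Rightarrow> poly3"
  assumes "n \<ge> 2"
    and "homogeneous (int n) G"
    and "smooth_plane_curve G"
    and "homogeneous (2 * int n - 3) U0"
    and "homogeneous (int n - 3) U1"
    and "homogeneous (2 * int n - 3) U2"
    and "\<And>i. homogeneous (2 * int n - 5) (R01 i)"
    and "\<And>i. homogeneous (2 * int n - 5) (R12 i)"
    and "U0 * U1 = (\<Sum>i\<in>UNIV. R01 i * pdiff i G)"
    and "U1 * U2 = (\<Sum>i\<in>UNIV. R12 i * pdiff i G)"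
  defines "W0 \<equiv> attached01 G U0" and "W1 \<equiv> attached10 G U1" and "W2 \<equiv> attached01 G U2"
    and "W01 \<equiv> cochain0 G 1
      (rat_form (coord 1 * R01 2 - coord 2 * R01 1) ((pdiff 0 G)\<^sup>2) (Omega1 0))
      (rat_form (- coord 0 * R01 2 + coord 2 * R01 0) ((pdiff 1 G)\<^sup>2) (Omega1 1))
      (rat_form (coord 0 * R01 1 - coord 1 * R01 0) ((pdiff 2 G)\<^sup>2) (Omega1 2))"
    and "W12 \<equiv> cochain0 G 1
      (rat_form (- (coord 1 * R12 2 - coord 2 * R12 1)) ((pdiff 0 G)\<^sup>2) (Omega1 0))
      (rat_form (- (- coord 0 * R12 2 + coord 2 * R12 0)) ((pdiff 1 G)\<^sup>2) (Omega1 1))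
      (rat_form (- (coord 0 * R12 1 - coord 1 * R12 0)) ((pdiff 2 G)\<^sup>2) (Omega1 2))"
  shows "W0 \<in> CdR G 0 1 \<and> W1 \<in> CdR G 1 0 \<and> W2 \<in> CdR G 0 1 \<and>
    W01 \<in> CdR G 1 0 \<and> W12 \<in> CdR G 1 0 \<and>
    total_D G 1 0 W01 = cech_bullet G 0 1 1 0 W0 W1 \<and>
    cech_bullet G 0 1 1 0 W0 W1 \<in> CdR G 1 1 \<and>
    total_D G 1 0 W12 = cech_bullet G 1 0 0 1 W1 W2 \<and>
    cech_bullet G 1 0 0 1 W1 W2 \<in> CdR G 1 1"
proof -
  note neq = index3_neq index3_neq[symmetric]
  have W01: "W01 = cross_cochain G R01"
    using neq by (simp add: W01_def cross_cochain_def cross_coeff_def)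
  \<comment> \<open>x \<times> R is linear in R, so the minus signs of \<open>W12\<close> pass to
    \<open>R12\<close>; this is the sign that \<open>total_D_cross_cochain_10_01\<close> asks
    for.\<close>
  have W12: "W12 = cross_cochain G (\<lambda>k. - R12 k)"
    using neq by (simp add: W12_def cross_cochain_def cross_coeff_def)
  have R12: "\<And>i. homogeneous (2 * int n - 5) (- R12 i)"
    by (intro homogeneous_uminus assms)
  have U12: "U1 * U2 = - (\<Sum>k\<in>UNIV. - R12 k * pdiff k G)"
    using assms by (simp add: sum_negf)
  show ?thesis
    unfolding W01 W12 W0_def W1_def W2_def
    using assms(2,4-10) R12 U12
    by (intro conjI attached01_in_CdR attached10_in_CdR cross_cochain_in_CdR
        total_D_cross_cochain_01_10 total_D_cross_cochain_10_01
        cech_bullet_01_10_in_CdR cech_bullet_10_01_in_CdR)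
qed

end
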